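(* Let $a$, $b$, $c$, and $d$ be indeterminates, let $k$ be an arbitrary integer and $N$ a nonnegative integer. Then $${}_8\psi_8\!\left[\begin{matrix}q\sqrt{a},-q\sqrt{a},b,c,dq^k,aq^{-k}/c,aq^{1+N}/b,aq^{-N}/d\\ \sqrt{a},-\sqrt{a},aq/b,aq/c,aq^{1-k}/d,cq^{1+k},bq^{-N},dq^{1+N}\end{matrix}\,;q,q\right]$$ $$=\frac{(aq/bc,cq/b,dq,dq/a;q)_N}{(cdq/a,dq/c,q/b,aq/b;q)_N}\cdot\frac{(cd/a,bd/a,cq,cq/a,dq^{1+N}/b,q^{-N};q)_k}{(q,cq/b,d/a,d,bcq^{-N}/a,cdq^{1+N}/a;q)_k}\cdot\frac{(q,q,aq,q/a,cdq/a,aq/cd,cq/d,dq/c;q)_{\infty}}{(cq,q/c,dq,q/d,cq/a,aq/c,dq/a,aq/d;q)_{\infty}}.$$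
   Context: Here $q$ is a fixed complex number with $0<|q|<1$. Notation: $(x;q)_\infty=\prod_{j\ge 0}(1-xq^j)$; for every integer $k$, $(x;q)_k=(x;q)_\infty/(xq^k;q)_\infty$, i.e. $(x;q)_k=\prod_{j=0}^{k-1}(1-xq^j)$ for $k\ge0$ and $(x;q)_{k}=\prod_{j=1}^{-k}(1-xq^{-j})^{-1}$ for $k<0$ (with $1/(q;q)_k=0$ for $k<0$); and $(x_1,\dots,x_m;q)_k=(x_1;q)_k\cdots(x_m;q)_k$ for $k$ an integer or $\infty$. In a parameter such as $aq/bc$ everything after the slash is in the denominator, i.e. $aq/bc=aq/(bc)$. The bilateral basic hypergeometric series is $${}_s\psi_s\!\left[\begin{matrix}a_1,\dots,a_s\\ b_1,\dots,b_s\end{matrix}\,;q,z\right]=\sum_{n=-\infty}^{\infty}\frac{(a_1,\dots,a_s;q)_n}{(b_1,\dots,b_s;q)_n}z^n.$$ The indeterminates are understood as nonzero complex numbers in general position (no denominator occurring in the statement vanishes); $\sqrt a$ is any fixed square root of $a$. *)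

theory Defs
  imports "HOL-Analysis.Analysis"
begin

definition qpoch_inf :: "complex \<Rightarrow> complex \<Rightarrow> complex" where
  "qpoch_inf x q = prodinf (\<lambda>j. 1 - x * q ^ j)"

text \<open>
  The finite shifted factorial is given in product form: the quotient
  \<open>qpoch_inf x q / qpoch_inf (x * q powi k) q\<close> (see \<open>qpoch_inf_eq_qpoch_mult\<close> below) degenerates
  to \<open>0 / 0\<close> for instance at \<open>x = q powi (- int N)\<close>, \<open>0 \<le> k \<le> N\<close>.  If \<open>k < 0\<close> and some factor
  \<open>1 - x * q powi (- j)\<close> vanishes, then \<open>qpoch x q k = 0\<close> because \<open>inverse 0 = 0\<close>, but the
  reciprocal still has the intended value \<open>1 / qpoch x q k = 0\<close>; this includes the usual
  convention that \<open>1 / qpoch q q k = 0\<close> for \<open>k < 0\<close>.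
\<close>

definition qpoch :: "complex \<Rightarrow> complex \<Rightarrow> int \<Rightarrow> complex" where
  "qpoch x q k =
     (if k \<ge> 0 then \<Prod>j\<in>{0..<k}. 1 - x * q powi j
      else \<Prod>j\<in>{1..-k}. inverse (1 - x * q powi (-j)))"

definition qpochs_inf :: "complex list \<Rightarrow> complex \<Rightarrow> complex" where
  "qpochs_inf xs q = (\<Prod>x\<leftarrow>xs. qpoch_inf x q)"

definition qpochs :: "complex list \<Rightarrow> complex \<Rightarrow> int \<Rightarrow> complex" where
  "qpochs xs q k = (\<Prod>x\<leftarrow>xs. qpoch x q k)"

definition psi_term :: "complex list \<Rightarrow> complex list \<Rightarrow> complex \<Rightarrow> complex \<Rightarrow> int \<Rightarrow> complex" where
  "psi_term xs ys q z n = qpochs xs q n / qpochs ys q n * z powi n"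

definition psi :: "complex list \<Rightarrow> complex list \<Rightarrow> complex \<Rightarrow> complex \<Rightarrow> complex" where
  "psi xs ys q z = (\<Sum>\<^sub>\<infinity>n\<in>UNIV. psi_term xs ys q z n)"

text \<open>
  Non-vanishing of the denominators in a quotient \<open>qpochs xs q k / qpochs ys q k\<close>.  For
  \<open>k \<ge> 0\<close> the factors in the denominator come from \<open>ys\<close>, for \<open>k < 0\<close> they come from \<open>xs\<close>; the
  index sets are empty in the respective other case.
\<close>

definition qpochs_quotient_defined ::
    "complex list \<Rightarrow> complex list \<Rightarrow> complex \<Rightarrow> int \<Rightarrow> bool" where
  "qpochs_quotient_defined xs ys q k \<longleftrightarrow>
     (\<forall>x\<in>set xs. \<forall>j\<in>{1..-k}. 1 - x * q powi (-j) \<noteq> 0) \<and>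
     (\<forall>y\<in>set ys. \<forall>j\<in>{0..<k}. 1 - y * q powi j \<noteq> 0)"

definition psi_defined :: "complex list \<Rightarrow> complex list \<Rightarrow> complex \<Rightarrow> bool" where
  "psi_defined xs ys q \<longleftrightarrow> (\<forall>n. qpochs_quotient_defined xs ys q n)"

lemma convergent_prod_qpoch_inf:
  fixes x q :: complex
  assumes "norm q < 1"
  shows "convergent_prod (\<lambda>j. 1 - x * q ^ j)"
proof -
  have "summable (\<lambda>j. norm x * norm q ^ j)"
    using assms by (intro summable_mult summable_geometric) auto
  then have "abs_convergent_prod (\<lambda>j. 1 - x * q ^ j)"
    by (subst abs_convergent_prod_conv_summable) (simp add: norm_mult norm_power)
  then show ?thesis by (rule abs_convergent_prod_imp_convergent_prod)
qed

lemma qpoch_inf_split_head: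
  assumes "norm q < 1"
  shows "qpoch_inf x q = (1 - x) * qpoch_inf (x * q) q"
proof -
  have lim: "(\<lambda>n. \<Prod>i\<le>n. 1 - y * q ^ i) \<longlonglongrightarrow> qpoch_inf y q" for y
    unfolding qpoch_inf_def
    by (rule convergent_prod_LIMSEQ[OF convergent_prod_qpoch_inf[OF assms]])
  have "(\<lambda>n. (1 - x) * (\<Prod>i\<le>n. 1 - x * q * q ^ i)) \<longlonglongrightarrow> (1 - x) * qpoch_inf (x * q) q"
    by (intro tendsto_mult_left lim)
  moreover have "(\<lambda>n. (1 - x) * (\<Prod>i\<le>n. 1 - x * q * q ^ i)) = (\<lambda>n. \<Prod>i\<le>Suc n. 1 - x * q ^ i)"
    by (subst prod.atMost_Suc_shift) (simp add: mult_ac)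
  ultimately show ?thesis
    using LIMSEQ_Suc[OF lim[of x]] LIMSEQ_unique by metis
qed

lemma qpoch_inf_split:
  assumes "norm q < 1"
  shows "qpoch_inf x q = (\<Prod>j<m. 1 - x * q ^ j) * qpoch_inf (x * q ^ m) q"
proof (induction m)
  case (Suc m)
  then show ?case
    using qpoch_inf_split_head[OF assms, of "x * q ^ m"] by (simp add: mult_ac)
qed simp

lemma qpoch_inf_eq_qpoch_mult:
  assumes q: "0 < norm q" "norm q < 1"
    and nz: "\<And>j. 1 \<le> j \<Longrightarrow> j \<le> -k \<Longrightarrow> 1 - x * q powi (-j) \<noteq> 0"
  shows "qpoch_inf x q = qpoch x q k * qpoch_inf (x * q powi k) q"
proof (cases "k \<ge> 0")
  case True
  then obtain m where k: "k = int m" using nonneg_int_cases by blast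
  have "(\<Prod>j\<in>{0..<k}. 1 - x * q powi j) = (\<Prod>j<m. 1 - x * q ^ j)"
    by (rule prod.reindex_bij_witness[of _ int nat]) (auto simp: k power_int_def)
  then show ?thesis
    using qpoch_inf_split[OF q(2), of x m] by (simp add: qpoch_def k)
next
  case False
  define m where "m = nat (-k)"
  have k: "k = - int m" using False by (simp add: m_def)
  have q0: "q \<noteq> 0" using q by auto
  have pow: "x * q powi k * q ^ j = x * q powi (int j - int m)" for j
    using q0 by (simp add: k power_int_diff power_int_minus divide_simps)
  have "(\<Prod>j<m. 1 - x * q powi k * q ^ j) = (\<Prod>j\<in>{1..-k}. 1 - x * q powi (-j))"
    unfolding pow
    by (rule prod.reindex_bij_witness[of _ "\<lambda>j. nat (int m - j)" "\<lambda>j. int m - int j"])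
      (auto simp: k)
  then have "qpoch x q k * (\<Prod>j<m. 1 - x * q powi k * q ^ j) = 1"
    using False nz by (simp add: qpoch_def flip: prod.distrib)
  moreover have "qpoch_inf (x * q powi k) q = (\<Prod>j<m. 1 - x * q powi k * q ^ j) * qpoch_inf x q"
  proof -
    have "x * q powi k * q ^ m = x" using pow[of m] by simp
    then show ?thesis using qpoch_inf_split[OF q(2), of "x * q powi k" m] by metis
  qed
  ultimately show ?thesis by (metis mult.assoc mult_1)
qed

end

theory Submission
  imports Defs
begin

text \<open>
  Put \<open>x = q^n\<close> and \<open>u = a x + 1/x\<close>.  The identity
  \<open>(1 - w x) (1 - a x / w) = x (u - (w + a / w))\<close> turns each well-poised pair of shifted factorials
  into factors that are linear in \<open>u\<close>.  In the series at hand the parameters come in pairs whose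
  shifted factorials cancel up to finitely many factors, so for \<open>0 \<le> k \<le> N\<close> and \<open>l = N - k\<close> the
  summand is, up to a constant,
    \<open>(1/x - a x) \<Prod>\<^bsub>1\<le>j\<le>N\<^esub> (u - \<beta>\<^sub>j) / (\<Prod>\<^bsub>0\<le>i\<le>k\<^esub> (u - \<gamma>\<^sub>i) \<Prod>\<^bsub>0\<le>j\<le>l\<^esub> (u - \<delta>\<^sub>j))\<close>,
  where the \<open>\<beta>\<^sub>j\<close>, \<open>\<gamma>\<^sub>i\<close>, \<open>\<delta>\<^sub>j\<close> are the values \<open>w + a / w\<close> at \<open>w = b q^(-j)\<close>, \<open>c q^i\<close> and
  \<open>d q^(k+j)\<close>.  For \<open>k < 0\<close> or \<open>k > N\<close> one of the two families of poles is missing and additional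
  zeros take its place (\<open>psi_term_eq_wp_term\<close>, \<open>psi_sum_outside_0\<close>).

  The whole family of sums is governed by the sum with one \<open>\<gamma>\<close>, one \<open>\<delta>\<close> and no \<open>\<beta>\<close>, a special
  case of Bailey's \<open>\<^sub>6\<psi>\<^sub>6\<close> sum (\<open>kernel_sum\<close>): as a function of \<open>\<gamma>\<close> it is the partial fraction
  expansion of a quotient of theta products, obtained by letting \<open>m\<close> tend to infinity in the
  partial fractions of \<open>\<Prod>\<^bsub>|j|\<le>m\<^esub> (\<gamma> - \<delta>\<^sub>j) / (\<gamma> - u\<^sub>j)\<close>.  That quotient vanishes if \<open>\<gamma>\<close> and \<open>\<delta>\<close>
  belong to the same family, hence all sums over the poles of a single family vanish, and this
  settles \<open>k < 0\<close> and \<open>k > N\<close>.  In the other cases write \<open>u - \<beta>\<^sub>N\<close> as a combination of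
  \<open>u - \<gamma>\<^sub>k\<close> and \<open>u - \<delta>\<^sub>l\<close>.  Each term loses one zero and one pole, which yields a two-term
  recurrence in \<open>(k, l)\<close>, and the recurrence is solved by an explicit product, the value of
  Jackson's terminating \<open>\<^sub>8\<phi>\<^sub>7\<close> sum (\<open>jackson_coeff_recurrence\<close>, \<open>well_poised_sum\<close>).

  The argument divides by differences of poles, and it requires that certain monomials in the
  parameters are not integral powers of \<open>q\<close>.
  Coinciding poles, and degenerations such as \<open>c = 1\<close> in which the series terminates, are reached
  by continuity (\<open>psi_tendsto\<close>): all parameters are multiplied by different powers of a real
  \<open>s\<close>, which tends to \<open>1\<close> while avoiding the countably many values that produce a coincidence.
\<close>

section \<open>Shifted factorials and theta products\<close>

locale nome =
  fixes q :: complex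
  assumes q_pos: "0 < norm q" and q_less_1: "norm q < 1"
begin

lemma q_nonzero [simp]: "q \<noteq> 0"
  using q_pos by auto

text \<open>
  The points at which theta products vanish are the integral powers of \<open>q\<close>.  A generic choice of
  parameters is one for which certain monomials in them avoid this set.
\<close>

definition off_lattice :: "complex \<Rightarrow> bool" where
  "off_lattice x \<longleftrightarrow> (\<forall>n::int. x \<noteq> q powi n)"

lemma off_lattice_shift: "off_lattice (x * q powi n) \<longleftrightarrow> off_lattice x"
proof -
  have "off_lattice (y * q powi m)" if "off_lattice y" for y m
    unfolding off_lattice_def
  proof
    fix i :: int
    have "y \<noteq> q powi (i - m)"
      using that by (simp add: off_lattice_def)
    then show "y * q powi m \<noteq> q powi i"
      by (simp add: power_int_diff field_simps)
  qed
  from this[of x n] this[of "x * q powi n" "- n"] show ?thesis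
    by (auto simp: mult.assoc simp flip: power_int_add)
qed

lemma off_lattice_inverse: "off_lattice (1 / x) \<longleftrightarrow> off_lattice x"
proof -
  have "off_lattice (1 / y)" if "off_lattice y" for y
    unfolding off_lattice_def
  proof
    fix i :: int
    have "y \<noteq> q powi (- i)"
      using that by (simp add: off_lattice_def)
    then show "1 / y \<noteq> q powi i"
      by (cases "y = 0") (auto simp: power_int_minus field_simps)
  qed
  from this[of x] this[of "1 / x"] show ?thesis by auto
qed

lemma off_lattice_factor:
  assumes "off_lattice x"
  shows "1 - x * q powi n \<noteq> 0" and "1 - x * q ^ m \<noteq> 0" and "1 - x \<noteq> 0"
proof -
  have *: "1 - x * q powi n \<noteq> 0" for n
  proof -
    have "off_lattice (x * q powi n)"
      using assms by (simp add: off_lattice_shift)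
    then have "x * q powi n \<noteq> q powi 0"
      unfolding off_lattice_def by blast
    then show ?thesis by auto
  qed
  show "1 - x * q powi n \<noteq> 0" by (rule *)
  show "1 - x * q ^ m \<noteq> 0" using *[of "int m"] by simp
  show "1 - x \<noteq> 0" using *[of 0] by simp
qed

lemma power_q_tendsto_0: "(\<lambda>n. q ^ n) \<longlonglongrightarrow> 0"
  using q_less_1 by (rule LIMSEQ_power_zero)

definition qfac :: "complex \<Rightarrow> nat \<Rightarrow> complex" where
  "qfac x n = (\<Prod>j<n. 1 - x * q ^ j)"

lemma qfac_0 [simp]: "qfac x 0 = 1"
  by (simp add: qfac_def)

lemma qfac_Suc: "qfac x (Suc n) = qfac x n * (1 - x * q ^ n)"
  by (simp add: qfac_def)

lemma qfac_add: "qfac x (m + n) = qfac x m * qfac (x * q ^ m) n"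
  by (induction n) (simp_all add: qfac_Suc power_add mult_ac)

lemma qfac_Suc': "qfac x (Suc n) = (1 - x) * qfac (x * q) n"
  using qfac_add[of x 1 n] by (simp add: qfac_Suc)

lemma qfac_tendsto: "(\<lambda>n. qfac x n) \<longlonglongrightarrow> qpoch_inf x q"
proof -
  have "(\<lambda>n. \<Prod>i\<le>n. 1 - x * q ^ i) \<longlonglongrightarrow> qpoch_inf x q"
    unfolding qpoch_inf_def
    by (rule convergent_prod_LIMSEQ[OF convergent_prod_qpoch_inf[OF q_less_1]])
  then have "(\<lambda>n. qfac x (Suc n)) \<longlonglongrightarrow> qpoch_inf x q"
    by (simp only: qfac_def lessThan_Suc_atMost)
  then show ?thesis by (rule LIMSEQ_imp_Suc)
qed

lemma qpoch_inf_nonzero: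
  assumes "\<And>n::nat. 1 - x * q ^ n \<noteq> 0"
  shows "qpoch_inf x q \<noteq> 0"
  unfolding qpoch_inf_def
  using convergent_prod_qpoch_inf[OF q_less_1] assms by (rule prodinf_nonzero)

lemma qpoch_inf_head: "qpoch_inf x q = (1 - x) * qpoch_inf (x * q) q"
  by (rule qpoch_inf_split_head[OF q_less_1])

text \<open>
  On bounded sets the factors differ from \<open>1\<close> by at most a fixed geometric sequence, so the product
  converges uniformly there.
\<close>

lemma continuous_on_qpoch_inf: "continuous_on (cball 0 r) (\<lambda>x. qpoch_inf x q)"
proof -
  have "uniformly_convergent_on (cball 0 r) (\<lambda>N x. \<Prod>n<N. 1 - x * q ^ n)"
  proof (rule uniformly_convergent_on_prod')
    show "uniformly_convergent_on (cball 0 r) (\<lambda>N x. \<Sum>n<N. norm (1 - x * q ^ n - 1))"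
    proof (rule Weierstrass_m_test'[where M = "\<lambda>n. r * norm q ^ n"])
      show "norm (norm (1 - x * q ^ n - 1)) \<le> r * norm q ^ n" if "x \<in> cball 0 r" for n x
        using that by (auto simp: norm_mult norm_power intro!: mult_right_mono)
      show "summable (\<lambda>n. r * norm q ^ n)"
        using q_less_1 by (intro summable_mult summable_geometric) auto
    qed
  qed (auto intro!: continuous_intros)
  then obtain l where l: "uniform_limit (cball 0 r) (\<lambda>N x. qfac x N) l sequentially"
    unfolding uniformly_convergent_on_def qfac_def by blast
  have "l x = qpoch_inf x q" if "x \<in> cball 0 r" for x
    using tendsto_uniform_limitI[OF l that] qfac_tendsto[of x] LIMSEQ_unique by blast
  moreover have "continuous_on (cball 0 r) l"
    by (rule uniform_limit_theorem[OF _ l]) (auto simp: qfac_def intro!: continuous_intros always_eventually)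
  ultimately show ?thesis by (auto intro: continuous_on_eq)
qed

lemma tendsto_qpoch_inf [tendsto_intros]:
  assumes "(f \<longlongrightarrow> x) F"
  shows "((\<lambda>i. qpoch_inf (f i) q) \<longlongrightarrow> qpoch_inf x q) F"
proof (rule isCont_tendsto_compose[OF _ assms])
  have "continuous_on (ball 0 (norm x + 1)) (\<lambda>x. qpoch_inf x q)"
    by (rule continuous_on_subset[OF continuous_on_qpoch_inf[of "norm x + 1"]]) auto
  then show "isCont (\<lambda>x. qpoch_inf x q) x"
    by (simp add: continuous_on_eq_continuous_at)
qed

definition theta :: "complex \<Rightarrow> complex" where
  "theta x = qpoch_inf x q * qpoch_inf (q / x) q"

lemma theta_shift:
  assumes "x \<noteq> 0"
  shows "theta (x * q) = - theta x / x"
proof -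
  have "q / (x * q) = 1 / x"
    by simp
  then have "theta (x * q) = qpoch_inf (x * q) q * ((1 - 1 / x) * qpoch_inf (q / x) q)"
    using qpoch_inf_head[of "1 / x"] by (simp add: theta_def)
  moreover have "theta x = (1 - x) * qpoch_inf (x * q) q * qpoch_inf (q / x) q"
    using qpoch_inf_head[of x] by (simp add: theta_def)
  moreover have "A * ((1 - 1 / x) * B) = - ((1 - x) * A * B) / x" for A B
    using assms by (simp add: field_simps)
  ultimately show ?thesis by simp
qed

lemma theta_head: "theta x = (1 - x) * (qpoch_inf (x * q) q * qpoch_inf (q / x) q)"
  using qpoch_inf_head[of x] by (simp add: theta_def)

lemma theta_nonzero:
  assumes "off_lattice x"
  shows "theta x \<noteq> 0"
proof -
  have "off_lattice (q / x)"
    using assms off_lattice_shift[of "1 / x" 1] by (simp add: off_lattice_inverse)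
  then show ?thesis
    using assms by (auto simp: theta_def intro!: qpoch_inf_nonzero dest: off_lattice_factor)
qed

lemma theta_power_eq_0: "theta (q ^ n) = 0"
proof (induction n)
  case 0
  show ?case using theta_head[of 1] by simp
next
  case (Suc n)
  then show ?case using theta_shift[of "q ^ n"] by (simp add: mult_ac)
qed

text \<open>
  Factors with negative index are turned round by \<open>1 - x / q^j = (- x / q^j) (1 - q^j / x)\<close>.  In a
  quotient of such products with equal products of the arguments, the monomials \<open>- x / q^j\<close> cancel,
  and what remains converges to theta products as the window grows.
\<close>

lemma window_prod:
  assumes "x \<noteq> 0"
  shows "(\<Prod>j\<in>{- int M..int L}. 1 - x * q powi j) =
         qfac x (Suc L) * qfac (q / x) M * (\<Prod>j<M. - x / q ^ Suc j)"
proof -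
  have split: "{- int M..int L} = {0..int L} \<union> {- int M..-1}" by auto
  have "(\<Prod>j\<in>{0..int L}. 1 - x * q powi j) = qfac x (Suc L)"
    unfolding qfac_def
    by (rule prod.reindex_bij_witness[of _ int nat]) (auto simp: power_int_def)
  moreover have "(\<Prod>j\<in>{- int M..-1}. 1 - x * q powi j) =
                 (\<Prod>j<M. (1 - q / x * q ^ j) * (- x / q ^ Suc j))"
    using assms
    by (intro prod.reindex_bij_witness[of _ "\<lambda>j. - int (Suc j)" "\<lambda>j. nat (- j - 1)"])
       (auto simp: power_int_def field_simps Suc_diff_Suc nat_diff_distrib simp flip: power_Suc)
  ultimately show ?thesis
    unfolding split prod.distrib
    by (subst prod.union_disjoint) (simp_all add: qfac_def mult.assoc)
qed

lemma window_prod_punctured: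
  "(\<Prod>j\<in>{- int M..int L} - {0}. 1 - q powi j) =
     qfac q L * qfac q M * (\<Prod>j<M. - 1 / q ^ Suc j)"
proof -
  have split: "{- int M..int L} - {0} = {1..int L} \<union> {- int M..-1}" by auto
  have "(\<Prod>j\<in>{1..int L}. 1 - q powi j) = qfac q L"
    unfolding qfac_def
    by (rule prod.reindex_bij_witness[of _ "\<lambda>j. int (Suc j)" "\<lambda>j. nat (j - 1)"])
       (auto simp: power_int_def Suc_nat_eq_nat_zadd1 simp flip: power_Suc)
  moreover have "(\<Prod>j\<in>{- int M..-1}. 1 - q powi j) =
                 (\<Prod>j<M. (1 - q * q ^ j) * (- 1 / q ^ Suc j))"
    by (intro prod.reindex_bij_witness[of _ "\<lambda>j. - int (Suc j)" "\<lambda>j. nat (- j - 1)"])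
       (auto simp: power_int_def field_simps Suc_diff_Suc nat_diff_distrib simp flip: power_Suc)
  ultimately show ?thesis
    unfolding split prod.distrib
    by (subst prod.union_disjoint) (simp_all add: qfac_def mult.assoc)
qed

end

section \<open>Partial fractions and the substitution behind well-poised series\<close>

text \<open>
  Dominated convergence for sums over \<open>\<int>\<close>, transferred from Tannery's theorem along an
  enumeration of the integers.
\<close>

lemma tannery_int:
  fixes f :: "int \<Rightarrow> 'i \<Rightarrow> complex"
  assumes lim: "\<And>n. ((\<lambda>i. f n i) \<longlongrightarrow> g n) F"
    and bound: "\<forall>\<^sub>F i in F. \<forall>n. norm (f n i) \<le> M n"
    and M: "M summable_on UNIV" and F: "F \<noteq> bot"
  shows "g summable_on UNIV" "((\<lambda>i. \<Sum>\<^sub>\<infinity>n. f n i) \<longlongrightarrow> (\<Sum>\<^sub>\<infinity>n. g n)) F"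
proof -
  have e: "bij_betw int_decode UNIV UNIV"
    by (rule bij_int_decode)
  have "summable (\<lambda>k. M (int_decode k))"
    using M by (intro summable_on_imp_summable) (subst summable_on_reindex_bij_betw[OF e])
  then have *: "(\<forall>\<^sub>F i in F. summable (\<lambda>k. norm (f (int_decode k) i))) \<and>
      summable (\<lambda>k. norm (g (int_decode k))) \<and>
      ((\<lambda>i. \<Sum>k. f (int_decode k) i) \<longlongrightarrow> (\<Sum>k. g (int_decode k))) F"
  proof (intro tannerys_theorem lim F)
    show "\<forall>\<^sub>F (k, i) in at_top \<times>\<^sub>F F. norm (f (int_decode k) i) \<le> M (int_decode k)"
      using bound by (intro eventually_mono[OF eventually_prod2[THEN iffD2]]) auto
  qed
  have eq: "(\<Sum>\<^sub>\<infinity>n. h n) = (\<Sum>k. h (int_decode k)) \<and> h summable_on UNIV"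
    if "summable (\<lambda>k. norm (h (int_decode k)))" for h :: "int \<Rightarrow> complex"
  proof -
    have "((\<lambda>k. h (int_decode k)) has_sum (\<Sum>k. h (int_decode k))) UNIV"
      using that by (rule norm_summable_imp_has_sum) (rule summable_sums[OF summable_norm_cancel[OF that]])
    then have "(h has_sum (\<Sum>k. h (int_decode k))) UNIV"
      by (subst (asm) has_sum_reindex_bij_betw[OF e])
    then show ?thesis by (auto intro: infsumI has_sum_imp_summable)
  qed
  show "g summable_on UNIV" using eq * by blast
  have "\<forall>\<^sub>F i in F. (\<Sum>\<^sub>\<infinity>n. f n i) = (\<Sum>k. f (int_decode k) i)"
    using * by (auto elim!: eventually_mono simp: eq)
  then show "((\<lambda>i. \<Sum>\<^sub>\<infinity>n. f n i) \<longlongrightarrow> (\<Sum>\<^sub>\<infinity>n. g n)) F"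
    using * eq[of g] by (simp add: tendsto_cong)
qed

text \<open>
  Lagrange interpolation: after multiplication by \<open>\<Prod>j\<in>S. z - u j\<close> both sides are polynomials in \<open>z\<close>
  of degree less than \<open>card S\<close>, and they agree at the nodes.
\<close>

lemma partial_fraction_linear_factors:
  fixes u v :: "'i \<Rightarrow> complex"
  assumes S: "finite S" "inj_on u S" and T: "card T < card S" and z: "z \<notin> u ` S"
  shows "(\<Prod>j\<in>T. z - v j) / (\<Prod>j\<in>S. z - u j) =
         (\<Sum>n\<in>S. (\<Prod>j\<in>T. u n - v j) / (\<Prod>j\<in>S - {n}. u n - u j) / (z - u n))"
proof -
  define p where "p = (\<Prod>j\<in>T. [:- v j, 1:])"
  define A where "A n = poly p (u n) / (\<Prod>j\<in>S - {n}. u n - u j)" for n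
  define r where "r = (\<Sum>n\<in>S. smult (A n) (\<Prod>j\<in>S - {n}. [:- u j, 1:]))"
  have deg: "degree (\<Prod>j\<in>X. [:- w j, 1:]) \<le> card X" for X and w :: "'i \<Rightarrow> complex"
    using degree_prod_sum_le[of X "\<lambda>j. [:- w j, 1:]"] by (cases "finite X") auto
  have "p = r"
  proof (rule poly_eqI_degree)
    show "card (u ` S) > degree p"
      using deg[of v T] T S by (simp add: p_def card_image)
    have "degree (smult (A n) (\<Prod>j\<in>S - {n}. [:- u j, 1:])) \<le> card S - 1" if "n \<in> S" for n
      using deg[of u "S - {n}"] that S(1) degree_smult_le[of "A n"] by (metis card_Diff_singleton order_trans)
    then have "degree r \<le> card S - 1"
      unfolding r_def by (intro degree_sum_le S)
    then show "card (u ` S) > degree r"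
      using T S by (simp add: card_image)
    show "poly p x = poly r x" if x: "x \<in> u ` S" for x
    proof -
      obtain m where m: "m \<in> S" "x = u m" using x by blast
      have "poly r x = (\<Sum>n\<in>S. A n * (\<Prod>j\<in>S - {n}. x - u j))"
        by (simp add: r_def poly_sum poly_prod)
      also have "\<dots> = (\<Sum>n\<in>{m}. A n * (\<Prod>j\<in>S - {n}. x - u j))"
        using m S by (intro sum.mono_neutral_right) (auto intro!: prod_zero bexI[of _ m])
      also have "(\<Prod>j\<in>S - {m}. u m - u j) \<noteq> 0"
        using m S by (auto simp: inj_on_def)
      then have "(\<Sum>n\<in>{m}. A n * (\<Prod>j\<in>S - {n}. x - u j)) = poly p x"
        by (simp add: A_def m)
      finally show ?thesis by simp
    qed
  qed
  moreover have "poly p z = (\<Prod>j\<in>T. z - v j)"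
    by (simp add: p_def poly_prod)
  ultimately have "(\<Prod>j\<in>T. z - v j) = poly r z"
    by simp
  also have "\<dots> = (\<Sum>n\<in>S. A n * (\<Prod>j\<in>S - {n}. z - u j))"
    by (simp add: r_def poly_sum poly_prod)
  finally have "(\<Prod>j\<in>T. z - v j) / (\<Prod>j\<in>S. z - u j) =
                (\<Sum>n\<in>S. A n * (\<Prod>j\<in>S - {n}. z - u j) / (\<Prod>j\<in>S. z - u j))"
    by (simp add: sum_divide_distrib)
  also have "\<dots> = (\<Sum>n\<in>S. A n / (z - u n))"
  proof (rule sum.cong)
    fix n assume n: "n \<in> S"
    have "(\<Prod>j\<in>S - {n}. z - u j) \<noteq> 0"
      using z S by auto
    then show "A n * (\<Prod>j\<in>S - {n}. z - u j) / (\<Prod>j\<in>S. z - u j) = A n / (z - u n)"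
      using prod.remove[OF S(1) n, of "\<lambda>j. z - u j"] by simp
  qed simp
  finally show ?thesis by (simp add: A_def p_def poly_prod)
qed

text \<open>
  Nodes are invariant under \<open>w \<mapsto> a / w\<close>; a well-poised pair of parameters enters only through its
  node.  The summation points \<open>u\<^sub>n\<close> below are themselves nodes.
\<close>

definition node :: "complex \<Rightarrow> complex \<Rightarrow> complex" where
  "node a w = w + a / w"

lemma node_diff:
  assumes "v \<noteq> 0" "w \<noteq> 0"
  shows "node a w - node a v = w * (1 - v / w) * (1 - a / (w * v))"
  using assms by (simp add: node_def field_simps)

context nome
begin

definition point :: "complex \<Rightarrow> int \<Rightarrow> complex" where
  "point a n = node a (q powi (- n))"

text \<open>
  The very-well-poised part \<open>1 - a q^(2n)\<close> of the summand, scaled so that it changes sign under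
  \<open>q^n \<mapsto> 1 / (a q^n)\<close>, the substitution that fixes \<open>point a n\<close>.
\<close>

definition weight :: "complex \<Rightarrow> int \<Rightarrow> complex" where
  "weight a n = q powi (- n) - a * q powi n"

lemma point_minus_node:
  assumes "w \<noteq> 0"
  shows "point a n - node a w = q powi (- n) * (1 - w * q powi n) * (1 - a / w * q powi n)"
  using assms by (simp add: point_def node_diff power_int_minus field_simps)

lemma weight_eq: "weight a n = q powi (- n) * (1 - a * q powi (2 * n))"
proof -
  have "q powi (2 * n) = q powi n * q powi n"
    by (simp flip: power_int_add)
  then show ?thesis
    by (simp add: weight_def power_int_minus field_simps)
qed

lemma point_ne_node:
  assumes "w \<noteq> 0" "off_lattice w" "off_lattice (a / w)"
  shows "point a n - node a w \<noteq> 0"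
  using assms(1) off_lattice_factor(1)[OF assms(2)] off_lattice_factor(1)[OF assms(3)]
  unfolding point_minus_node[OF assms(1)] by (intro no_zero_divisors) auto

lemma inj_point:
  assumes "off_lattice a"
  shows "inj_on (point a) S"
proof (rule inj_onI)
  fix m n assume "point a m = point a n"
  then have "(1 - q powi (- n) * q powi m) * (1 - a / q powi (- n) * q powi m) = 0"
    using point_minus_node[of "q powi (- n)" a m] by (simp add: point_def)
  moreover have "a / q powi (- n) * q powi m = a * q powi (n + m)"
    by (simp add: power_int_minus power_int_add field_simps)
  ultimately have "1 - q powi (- n) * q powi m = 0"
    using off_lattice_factor(1)[OF assms, of "n + m"] by (metis mult_eq_0_iff)
  then have "q powi m = q powi n"
    by (simp add: power_int_minus field_simps)
  then have "norm q powi m = norm q powi n"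
    by (metis norm_power_int)
  then show "m = n"
    using power_int_strict_decreasing[of _ _ "norm q", OF _ q_pos q_less_1]
    by (cases m n rule: linorder_cases) force+
qed

end

section \<open>The sum with two pairs of poles\<close>

lemma summable_on_int:
  fixes f :: "int \<Rightarrow> real"
  assumes "summable (\<lambda>m. f (int m))" "summable (\<lambda>m. f (- int m))" "\<And>n. f n \<ge> 0"
  shows "f summable_on UNIV"
proof -
  have "(\<lambda>m. f (int m)) summable_on UNIV" "(\<lambda>m. f (- int m)) summable_on UNIV"
    using assms by (auto simp: summable_on_UNIV_nonneg_real_iff)
  then have "f summable_on (range int)" "f summable_on (range (\<lambda>m. - int m))"
    by (auto simp: summable_on_reindex inj_on_def o_def)
  then have "f summable_on (range int \<union> range (\<lambda>m. - int m))"
    by (rule summable_on_union)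
  also have "range int \<union> range (\<lambda>m. - int m) = UNIV"
    by (auto simp: image_iff) (metis int_cases2)
  finally show ?thesis .
qed

lemma abs_summable_int_geometric:
  fixes f :: "int \<Rightarrow> complex" and q :: complex
  assumes q: "0 < norm q" "norm q < 1"
    and pos: "(\<lambda>m. f (int m) / q ^ m) \<longlonglongrightarrow> l"
    and neg: "(\<lambda>m. f (- int m) / q ^ m) \<longlonglongrightarrow> l'"
  shows "(\<lambda>n. norm (f n)) summable_on UNIV"
proof -
  have "Bseq (\<lambda>m. f (int m) / q ^ m)" "Bseq (\<lambda>m. f (- int m) / q ^ m)"
    using pos neg by (auto intro: convergent_imp_Bseq convergentI)
  then obtain C D where C: "\<And>m. norm (f (int m) / q ^ m) \<le> C"
    and D: "\<And>m. norm (f (- int m) / q ^ m) \<le> D"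
    by (auto elim!: BseqE)
  have le: "norm x \<le> E * norm q ^ m" if "norm (x / q ^ m) \<le> E" for x E m
    using that q by (simp add: norm_divide norm_power field_simps)
  have "summable (\<lambda>m. norm (f (int m)))" "summable (\<lambda>m. norm (f (- int m)))"
    by (rule summable_comparison_test'[of "\<lambda>m. C * norm q ^ m"];
        use q le[OF C] in \<open>auto intro!: summable_mult summable_geometric\<close>)
       (rule summable_comparison_test'[of "\<lambda>m. D * norm q ^ m"];
        use q le[OF D] in \<open>auto intro!: summable_mult summable_geometric\<close>)
  then show ?thesis by (rule summable_on_int) simp
qed

context nome
begin

text \<open>
  The summand behaves like \<open>q^n\<close> as \<open>n\<close> tends to \<open>\<infinity>\<close> and like \<open>q^(-n)\<close> as it tends to \<open>-\<infinity>\<close>.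
\<close>

lemma kernel_summable:
  assumes nz: "a \<noteq> 0" "c \<noteq> 0" "d \<noteq> 0"
    and off: "off_lattice c" "off_lattice (a / c)" "off_lattice d" "off_lattice (a / d)"
  shows "(\<lambda>n. norm (weight a n / ((point a n - node a c) * (point a n - node a d)))) summable_on UNIV"
    (is "(\<lambda>n. norm (?t n)) summable_on UNIV")
proof -
  have pos: "?t (int m) / q ^ m = (1 - a * q ^ m * q ^ m) /
      ((1 - c * q ^ m) * (1 - a / c * q ^ m) * ((1 - d * q ^ m) * (1 - a / d * q ^ m)))" for m
  proof -
    define x where "x = q ^ m"
    have x: "x \<noteq> 0" "q powi int m = x" "q powi (- int m) = 1 / x"
      by (simp_all add: x_def power_int_minus_divide)
    have "?t (int m) = (1 / x - a * x) / ((1 / x * (1 - c * x) * (1 - a / c * x)) *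
        (1 / x * (1 - d * x) * (1 - a / d * x)))"
      unfolding weight_def point_minus_node[OF nz(2)] point_minus_node[OF nz(3)] x ..
    also have "\<dots> / x = (1 - a * x * x) /
        ((1 - c * x) * (1 - a / c * x) * ((1 - d * x) * (1 - a / d * x)))"
      (is "_ / (?A * ?B) / x = _ / (?C * ?D)")
    proof -
      have e: "?A = ?C / x" "?B = ?D / x" "1 / x - a * x = (1 - a * x * x) / x"
        using x(1) by (simp_all add: field_simps)
      show ?thesis unfolding e using x(1) by simp
    qed
    finally show ?thesis by (simp add: x_def)
  qed
  have neg: "?t (- int m) / q ^ m = - a * (1 - 1 / a * q ^ m * q ^ m) /
      ((c - q ^ m) * (a / c - q ^ m) * ((d - q ^ m) * (a / d - q ^ m)))" for m
  proof -
    define x where "x = q ^ m"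
    have x: "x \<noteq> 0" "q powi (- int m) = 1 / x" "q powi (- (- int m)) = x"
      by (simp_all add: x_def power_int_minus_divide)
    have "?t (- int m) = (x - a * (1 / x)) / ((x * (1 - c * (1 / x)) * (1 - a / c * (1 / x))) *
        (x * (1 - d * (1 / x)) * (1 - a / d * (1 / x))))"
      unfolding weight_def point_minus_node[OF nz(2)] point_minus_node[OF nz(3)] x ..
    also have "\<dots> / x = - a * (1 - 1 / a * x * x) /
        ((c - x) * (a / c - x) * ((d - x) * (a / d - x)))"
      (is "_ / (?A * ?B) / x = _ / (?C * ?D)")
    proof -
      have e: "?A = ?C / x" "?B = ?D / x" "x - a * (1 / x) = - a * (1 - 1 / a * x * x) / x"
        using x(1) nz by (simp_all add: field_simps)
      show ?thesis unfolding e using x(1) by simp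
    qed
    finally show ?thesis by (simp add: x_def)
  qed
  show ?thesis
  proof (rule abs_summable_int_geometric[OF q_pos q_less_1])
    show "(\<lambda>m. ?t (int m) / q ^ m) \<longlonglongrightarrow> (1 - a * 0 * 0) /
      ((1 - c * 0) * (1 - a / c * 0) * ((1 - d * 0) * (1 - a / d * 0)))"
      unfolding pos by (intro tendsto_intros power_q_tendsto_0) auto
    show "(\<lambda>m. ?t (- int m) / q ^ m) \<longlonglongrightarrow> - a * (1 - 1 / a * 0 * 0) /
      ((c - 0) * (a / c - 0) * ((d - 0) * (a / d - 0)))"
      unfolding neg by (intro tendsto_intros power_q_tendsto_0) (use nz in auto)
  qed
qed

lemma window_quotient_tendsto:
  assumes nz: "x \<noteq> 0" "y \<noteq> 0" "z \<noteq> 0" "w \<noteq> 0" and bal: "x * y = z * w"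
    and off: "off_lattice z" "off_lattice w"
  shows "(\<lambda>m. \<Prod>j\<in>{- int m..int m}. ((1 - x * q powi j) * (1 - y * q powi j)) /
              ((1 - z * q powi j) * (1 - w * q powi j)))
         \<longlonglongrightarrow> theta x * theta y / (theta z * theta w)"
proof -
  have mono: "(\<Prod>j<m. - x / q ^ Suc j) * (\<Prod>j<m. - y / q ^ Suc j) =
              (\<Prod>j<m. - z / q ^ Suc j) * (\<Prod>j<m. - w / q ^ Suc j)" for m
    unfolding prod.distrib[symmetric] using bal by (intro prod.cong) auto
  have nzm: "(\<Prod>j<m. - z / q ^ Suc j) * (\<Prod>j<m. - w / q ^ Suc j) \<noteq> 0" for m
    using nz by simp
  have "(\<Prod>j\<in>{- int m..int m}. ((1 - x * q powi j) * (1 - y * q powi j)) /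
              ((1 - z * q powi j) * (1 - w * q powi j))) =
        (qfac x (Suc m) * qfac (q / x) m * (qfac y (Suc m) * qfac (q / y) m)) /
        (qfac z (Suc m) * qfac (q / z) m * (qfac w (Suc m) * qfac (q / w) m))" for m
  proof -
    have "(A * B * P) * (C * D * P') / ((E * F * R) * (G * H * R')) =
          (A * B * (C * D)) / (E * F * (G * H))"
      if "P * P' = R * R'" "R * R' \<noteq> 0" for A B C D E F G H P P' R R' :: complex
    proof -
      have e: "(A * B * P) * (C * D * P') = (A * B * (C * D)) * (P * P')"
           "(E * F * R) * (G * H * R') = (E * F * (G * H)) * (R * R')"
        by (simp_all add: mult_ac)
      show ?thesis unfolding e that(1) using that(2) by simp
    qed
    note cancel = this
    have "(\<Prod>j\<in>{- int m..int m}. ((1 - x * q powi j) * (1 - y * q powi j)) /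
              ((1 - z * q powi j) * (1 - w * q powi j))) =
          ((\<Prod>j\<in>{- int m..int m}. 1 - x * q powi j) * (\<Prod>j\<in>{- int m..int m}. 1 - y * q powi j)) /
          ((\<Prod>j\<in>{- int m..int m}. 1 - z * q powi j) * (\<Prod>j\<in>{- int m..int m}. 1 - w * q powi j))"
      by (simp only: prod_dividef prod.distrib)
    then show ?thesis
      unfolding window_prod[OF nz(1)] window_prod[OF nz(2)]
        window_prod[OF nz(3)] window_prod[OF nz(4)] cancel[OF mono nzm] .
  qed
  moreover have "(\<lambda>m. (qfac x (Suc m) * qfac (q / x) m * (qfac y (Suc m) * qfac (q / y) m)) /
        (qfac z (Suc m) * qfac (q / z) m * (qfac w (Suc m) * qfac (q / w) m)))
      \<longlonglongrightarrow> (theta x * theta y) / (theta z * theta w)"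
    using theta_nonzero[OF off(1)] theta_nonzero[OF off(2)] unfolding theta_def
    by (intro tendsto_intros qfac_tendsto LIMSEQ_Suc) auto
  ultimately show ?thesis by simp
qed

text \<open>
  The residue at \<open>u\<^sub>n\<close> of the truncated product in \<open>kernel_sum\<close>.  The substitutions \<open>j \<mapsto> n + j\<close>
  and \<open>j \<mapsto> n - j\<close> map the symmetric range of \<open>j\<close> to the same window \<open>{-M..L}\<close>, so that the residue
  depends on \<open>n\<close>, apart from the weight, only through the lengths \<open>L\<close> and \<open>M\<close>.  The factor omitted
  at \<open>j = n\<close> accounts for \<open>1 - a q^(2n)\<close> in the weight.
\<close>

lemma residue_window:
  assumes nz: "a \<noteq> 0" "d \<noteq> 0" and off: "off_lattice a" and n: "n \<in> {- int m..int m}"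
  defines "L \<equiv> nat (int m + n)" and "M \<equiv> nat (int m - n)"
  shows "(\<Prod>j\<in>{- int m..int m}. point a n - node a (d * q powi j)) /
         (\<Prod>j\<in>{- int m..int m} - {n}. point a n - point a j) =
         weight a n * (qfac d (Suc L) * qfac (a / d) (Suc L) / (qfac q L * qfac a (Suc L)) *
           (qfac (q / d) M * qfac (q / (a / d)) M / (qfac q M * qfac (q / a) M)))"
proof -
  define J where "J = {- int m..int m}"
  define W where "W = {- int M..int L}"
  define K where "K = q powi (- n)"
  define s where "s = card (J - {n})"
  have J: "finite J" "n \<in> J" "card J = Suc s"
    using n by (auto simp: J_def s_def intro: card.remove)
  have L: "int L = int m + n" "int M = int m - n"
    using n by (auto simp: L_def M_def)
  have reidx: "(\<Prod>j\<in>J. 1 - x * q powi (n + j)) = (\<Prod>l\<in>W. 1 - x * q powi l)"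
             "(\<Prod>j\<in>J. 1 - x * q powi (n - j)) = (\<Prod>l\<in>W. 1 - x * q powi l)" for x
    unfolding J_def W_def
    by (rule prod.reindex_bij_witness[of _ "\<lambda>l. l - n" "\<lambda>j. n + j"]; use L in simp)
       (rule prod.reindex_bij_witness[of _ "\<lambda>l. n - l" "\<lambda>j. n - j"]; use L in simp)
  have punct: "(\<Prod>j\<in>J - {n}. 1 - q powi (n - j)) = (\<Prod>l\<in>W - {0}. 1 - q powi l)"
    unfolding J_def W_def
    by (rule prod.reindex_bij_witness[of _ "\<lambda>l. n - l" "\<lambda>j. n - j"]; use L in auto)
  have "(\<Prod>j\<in>J. point a n - node a (d * q powi j)) =
        (\<Prod>j\<in>J. K * (1 - d * q powi (n + j)) * (1 - a / d * q powi (n - j)))"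
  proof (rule prod.cong[OF refl])
    fix j
    have e: "a / (d * q powi j) * q powi n = a / d * q powi (n - j)" "d * q powi j * q powi n = d * q powi (n + j)"
      by (simp_all add: power_int_add power_int_diff)
    show "point a n - node a (d * q powi j) = K * (1 - d * q powi (n + j)) * (1 - a / d * q powi (n - j))"
      using nz point_minus_node[of "d * q powi j" a n] unfolding e K_def by simp
  qed
  also have "\<dots> = K ^ Suc s * (\<Prod>l\<in>W. 1 - d * q powi l) * (\<Prod>l\<in>W. 1 - a / d * q powi l)"
    by (simp only: prod.distrib reidx prod_constant J)
  finally have num: "(\<Prod>j\<in>J. point a n - node a (d * q powi j)) = \<dots>" .
  have "(\<Prod>j\<in>J - {n}. point a n - point a j) =
        (\<Prod>j\<in>J - {n}. K * (1 - q powi (n - j)) * (1 - a * q powi (n + j)))"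
  proof (rule prod.cong[OF refl])
    fix j
    have e: "a / q powi (- j) * q powi n = a * q powi (n + j)" "q powi (- j) * q powi n = q powi (n - j)"
      by (simp_all add: power_int_add power_int_diff power_int_minus field_simps)
    show "point a n - point a j = K * (1 - q powi (n - j)) * (1 - a * q powi (n + j))"
      using point_minus_node[of "q powi (- j)" a n] unfolding e K_def by (simp add: point_def)
  qed
  then have "(\<Prod>j\<in>J - {n}. point a n - point a j) * (1 - a * q powi (2 * n)) =
        K ^ s * (\<Prod>j\<in>J - {n}. 1 - q powi (n - j)) *
          ((1 - a * q powi (n + n)) * (\<Prod>j\<in>J - {n}. 1 - a * q powi (n + j)))"
    by (simp add: prod.distrib s_def)
  also have "(1 - a * q powi (n + n)) * (\<Prod>j\<in>J - {n}. 1 - a * q powi (n + j)) = (\<Prod>l\<in>W. 1 - a * q powi l)"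
    using prod.remove[OF J(1,2), of "\<lambda>j. 1 - a * q powi (n + j)"] reidx(1)[of a] by simp
  finally have den: "(\<Prod>j\<in>J - {n}. point a n - point a j) * (1 - a * q powi (2 * n)) =
        K ^ s * (\<Prod>l\<in>W - {0}. 1 - q powi l) * (\<Prod>l\<in>W. 1 - a * q powi l)"
    by (simp add: punct)
  define P where "P x = (\<Prod>j<M. - x / q ^ Suc j)" for x
  have mono: "P d * P (a / d) = P 1 * P a"
    unfolding prod.distrib[symmetric] P_def using nz by (intro prod.cong) auto
  have nzP: "P 1 * P a \<noteq> 0"
    using nz by (simp add: P_def)
  have ad: "a / d \<noteq> 0" using nz by simp
  have e: "1 - a * q powi (2 * n) \<noteq> 0" "K \<noteq> 0"
    using off_lattice_factor(1)[OF off] by (auto simp: K_def)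
  have comb: "N / D = K * e * (A * C / (E * G) * (B * F / (R * H)))"
    if "N = K ^ Suc s * (A * B * P1) * (C * F * P2)" "D * e = K ^ s * (E * R * P3) * (G * H * P4)"
       "P1 * P2 = P3 * P4" "P3 * P4 \<noteq> 0" "e \<noteq> 0" for N D e A B C E F G H R P1 P2 P3 P4
  proof -
    have 1: "N = (P3 * P4 * K ^ s) * (K * (A * C * (B * F)))"
      using that(1) unfolding that(3)[symmetric] by (simp add: mult_ac)
    have 2: "D = (P3 * P4 * K ^ s) * (E * G * (R * H) / e)"
      using that(2,5) by (simp add: field_simps)
    have "P3 * P4 * K ^ s \<noteq> 0"
      using that(4) e(2) by simp
    then have "N / D = (K * (A * C * (B * F))) / (E * G * (R * H) / e)"
      unfolding 1 2 by (rule mult_divide_mult_cancel_left)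
    then show ?thesis by simp
  qed
  have "(\<Prod>j\<in>J. point a n - node a (d * q powi j)) / (\<Prod>j\<in>J - {n}. point a n - point a j) =
        K * (1 - a * q powi (2 * n)) *
          (qfac d (Suc L) * qfac (a / d) (Suc L) / (qfac q L * qfac a (Suc L)) *
           (qfac (q / d) M * qfac (q / (a / d)) M / (qfac q M * qfac (q / a) M)))"
    by (rule comb[OF num[unfolded W_def window_prod[OF nz(2)] window_prod[OF ad], folded P_def]
          den[unfolded W_def window_prod[OF nz(1)] window_prod_punctured, folded P_def] mono nzP e(1)])
  then show ?thesis
    by (simp only: J_def K_def weight_eq)
qed

text \<open>
  Expand \<open>\<Prod>\<^bsub>|j|\<le>m\<^esub> (\<gamma> - \<delta>\<^sub>j) / (\<gamma> - u\<^sub>j)\<close> in partial fractions with respect to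
  \<open>\<gamma> = node a c\<close>, where \<open>\<delta>\<^sub>j = node a (d q^j)\<close>.  The factor with \<open>j = 0\<close> of the numerator is set aside
  first.  It makes the degree of the numerator smaller than that of the denominator, and it
  produces the second denominator \<open>u\<^sub>n - node a d\<close>.  As \<open>m\<close> grows, the product tends to a quotient
  of theta products, while the coefficients are uniformly bounded and tend to a constant
  multiple of the weight.

  The factor \<open>node a d - node a c\<close> is kept on the left so that the formula also shows that the
  sum vanishes when \<open>d / c\<close> is a power of \<open>q\<close> and the nodes differ.
\<close>

theorem kernel_sum:
  assumes nz: "a \<noteq> 0" "c \<noteq> 0" "d \<noteq> 0" and off: "off_lattice a"
    "off_lattice c" "off_lattice (a / c)" "off_lattice d" "off_lattice (a / d)"
  shows "(node a d - node a c) *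
           (\<Sum>\<^sub>\<infinity>n. weight a n / ((point a n - node a c) * (point a n - node a d))) =
         qpoch_inf q q ^ 2 * theta a * theta (d / c) * theta (a / (c * d)) /
           (theta (1 / c) * theta (a / c) * theta d * theta (a / d))"
    (is "_ * infsum ?t UNIV = _")
proof -
  define X where "X L = qfac d (Suc L) * qfac (a / d) (Suc L) / (qfac q L * qfac a (Suc L))" for L
  define Y where "Y M = qfac (q / d) M * qfac (q / (a / d)) M / (qfac q M * qfac (q / a) M)" for M
  define J where "J m = {- int m..int m}" for m
  define f where "f n m = (if n \<in> J m then ?t n * (X (nat (int m + n)) * Y (nat (int m - n))) else 0)" for n m
  define lX where "lX = qpoch_inf d q * qpoch_inf (a / d) q / (qpoch_inf q q * qpoch_inf a q)"
  define lY where "lY = qpoch_inf (q / d) q * qpoch_inf (q / (a / d)) q / (qpoch_inf q q * qpoch_inf (q / a) q)"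
  have "q ^ n \<noteq> 1" if "n > 0" for n
    using power_less_one_iff[of "norm q" n] q_less_1 that by (metis less_irrefl norm_ge_zero norm_one norm_power)
  from this[of "Suc _"] have qq: "qpoch_inf q q \<noteq> 0"
    by (intro qpoch_inf_nonzero) auto
  have th_a: "qpoch_inf a q \<noteq> 0" "qpoch_inf (q / a) q \<noteq> 0"
    using theta_nonzero[OF off(1)] by (auto simp: theta_def)
  have limX: "X \<longlonglongrightarrow> lX" and limY: "Y \<longlonglongrightarrow> lY"
    unfolding X_def Y_def lX_def lY_def using qq th_a
    by (auto intro!: tendsto_intros qfac_tendsto LIMSEQ_Suc)
  obtain BX where BX: "\<And>L. norm (X L) \<le> BX"
    using limX by (metis convergentI convergent_imp_Bseq BseqE)
  obtain BY where BY: "\<And>M. norm (Y M) \<le> BY"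
    using limY by (metis convergentI convergent_imp_Bseq BseqE)
  \<comment> \<open>The sum over the poles; its terms outside the window \<open>J m\<close> are zero.\<close>
  have "((\<lambda>m. \<Sum>\<^sub>\<infinity>n. f n m) \<longlongrightarrow> (\<Sum>\<^sub>\<infinity>n. ?t n * (lX * lY))) sequentially"
  proof (rule tannery_int(2))
    fix n :: int
    have filt: "filterlim (\<lambda>m. nat (int m + n)) sequentially sequentially"
      "filterlim (\<lambda>m. nat (int m - n)) sequentially sequentially"
      by (rule filterlim_at_top_mono[OF filterlim_minus_const_nat_at_top[of "nat \<bar>n\<bar>"]],
          rule always_eventually, rule allI, arith)+
    have "\<forall>\<^sub>F m in sequentially. f n m = ?t n * (X (nat (int m + n)) * Y (nat (int m - n)))"
      using eventually_ge_at_top[of "nat \<bar>n\<bar>"] by eventually_elim (auto simp: f_def J_def)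
    moreover have "(\<lambda>m. ?t n * (X (nat (int m + n)) * Y (nat (int m - n)))) \<longlonglongrightarrow> ?t n * (lX * lY)"
      by (intro tendsto_intros filterlim_compose[OF limX filt(1)] filterlim_compose[OF limY filt(2)])
    ultimately show "(\<lambda>m. f n m) \<longlonglongrightarrow> ?t n * (lX * lY)"
      by (simp add: tendsto_cong)
  next
    have B0: "BX \<ge> 0" "BY \<ge> 0"
      using norm_ge_zero[THEN order_trans, OF BX] norm_ge_zero[THEN order_trans, OF BY] by auto
    have "norm (f n m) \<le> norm (?t n) * (BX * BY)" for n m
    proof (cases "n \<in> J m")
      case True
      then have "norm (f n m) = norm (?t n) * (norm (X (nat (int m + n))) * norm (Y (nat (int m - n))))"
        by (simp only: f_def if_True norm_mult)
      also have "\<dots> \<le> norm (?t n) * (BX * BY)"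
        by (intro mult_left_mono mult_mono BX BY B0) auto
      finally show ?thesis .
    qed (use B0 in \<open>auto simp: f_def\<close>)
    then show "\<forall>\<^sub>F m in sequentially. \<forall>n. norm (f n m) \<le> norm (?t n) * (BX * BY)"
      by simp
    show "(\<lambda>n. norm (?t n) * (BX * BY)) summable_on UNIV"
      by (intro summable_on_cmult_left kernel_summable nz off)
  qed auto
  then have lim1: "(\<lambda>m. (node a d - node a c) * (\<Sum>\<^sub>\<infinity>n. f n m)) \<longlonglongrightarrow>
               (node a d - node a c) * (infsum ?t UNIV * (lX * lY))"
    by (subst (asm) infsum_cmult_left') (intro tendsto_intros)
  have off_c: "off_lattice (1 / c)"
    using off by (simp add: off_lattice_inverse)
  have "(node a d - node a c) * (\<Sum>\<^sub>\<infinity>n. f n m) =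
        (\<Prod>j\<in>J m. ((1 - d / c * q powi j) * (1 - a / (c * d) * q powi j)) /
                   ((1 - 1 / c * q powi j) * (1 - a / c * q powi j)))" for m
  proof -
    have J: "finite (J m)" "0 \<in> J m"
      by (auto simp: J_def)
    have neg: "(\<Prod>j\<in>J m. h (- j)) = (\<Prod>j\<in>J m. h j)" for h :: "int \<Rightarrow> complex"
      unfolding J_def by (rule prod.reindex_bij_witness[of _ uminus uminus]) auto
    have zero: "node a (d * q powi 0) = node a d"
      by simp
    have ne: "point a n - node a c \<noteq> 0" "point a n - node a d \<noteq> 0" for n
      using nz off by (simp_all only: point_ne_node not_False_eq_True)
    have notin: "node a c \<notin> point a ` J m"
      using ne(1) by (metis (no_types, lifting) imageE diff_self)
    have "(\<Prod>j\<in>J m - {0}. node a c - node a (d * q powi j)) / (\<Prod>j\<in>J m. node a c - point a j) =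
        (\<Sum>n\<in>J m. (\<Prod>j\<in>J m - {0}. point a n - node a (d * q powi j)) /
           (\<Prod>j\<in>J m - {n}. point a n - point a j) / (node a c - point a n))"
      using J notin
      by (intro partial_fraction_linear_factors inj_point off(1)) (auto simp del: card_Diff_insert intro!: card_Diff1_less)
    also have "\<dots> = (\<Sum>n\<in>J m. - f n m)"
    proof (rule sum.cong)
      fix n assume n: "n \<in> J m"
      have "(\<Prod>j\<in>J m. point a n - node a (d * q powi j)) =
            (point a n - node a d) * (\<Prod>j\<in>J m - {0}. point a n - node a (d * q powi j))"
        using prod.remove[OF J, of "\<lambda>j. point a n - node a (d * q powi j)"] by simp
      then have 1: "(\<Prod>j\<in>J m - {0}. point a n - node a (d * q powi j)) =
          (\<Prod>j\<in>J m. point a n - node a (d * q powi j)) / (point a n - node a d)"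
        using ne by simp
      have 2: "(\<Prod>j\<in>J m. point a n - node a (d * q powi j)) / (\<Prod>j\<in>J m - {n}. point a n - point a j) =
               weight a n * (X (nat (int m + n)) * Y (nat (int m - n)))"
        using residue_window[OF nz(1,3) off(1) n[unfolded J_def]] by (simp only: J_def X_def Y_def)
      have swap: "A / e / B / (g - p) = - (w / ((p - g) * e) * z)" if "A / B = w * z" for A B e g p w z :: complex
      proof -
        have "A / e / B / - (p - g) = - ((A / B) / ((p - g) * e))"
          by (simp only: divide_divide_eq_left mult_minus_right minus_divide_right[symmetric] mult_ac)
        then show ?thesis unfolding that by simp
      qed
      show "(\<Prod>j\<in>J m - {0}. point a n - node a (d * q powi j)) /
           (\<Prod>j\<in>J m - {n}. point a n - point a j) / (node a c - point a n) = - f n m"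
        unfolding 1 using swap[OF 2] n by (simp add: f_def)
    qed simp
    also have "\<dots> = - (\<Sum>\<^sub>\<infinity>n. f n m)"
    proof -
      have "(\<Sum>\<^sub>\<infinity>n. f n m) = (\<Sum>\<^sub>\<infinity>n\<in>J m. f n m)"
        by (rule infsum_cong_neutral) (auto simp: f_def)
      then show ?thesis using J by (simp add: sum_negf)
    qed
    finally have "(node a d - node a c) * (\<Sum>\<^sub>\<infinity>n. f n m) =
        (node a c - node a (d * q powi 0)) * ((\<Prod>j\<in>J m - {0}. node a c - node a (d * q powi j)) /
          (\<Prod>j\<in>J m. node a c - point a j))"
      by (simp add: algebra_simps)
    also have "\<dots> = (\<Prod>j\<in>J m. node a c - node a (d * q powi j)) / (\<Prod>j\<in>J m. node a c - point a j)"
      using prod.remove[OF J, of "\<lambda>j. node a c - node a (d * q powi j)"] by simp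
    also have "(\<Prod>j\<in>J m. node a c - node a (d * q powi j)) =
        (\<Prod>j\<in>J m. c * (1 - d / c * q powi j) * (1 - a / (c * d) * q powi (- j)))"
      using nz by (intro prod.cong refl) (simp add: node_diff power_int_minus divide_simps)
    also have "\<dots> = (\<Prod>j\<in>J m. c * (1 - d / c * q powi j) * (1 - a / (c * d) * q powi j))"
      by (simp only: prod.distrib neg[of "\<lambda>j. 1 - a / (c * d) * q powi j"])
    also have "(\<Prod>j\<in>J m. node a c - point a j) =
        (\<Prod>j\<in>J m. c * (1 - 1 / c * q powi (- j)) * (1 - a / c * q powi j))"
      unfolding point_def using nz by (intro prod.cong refl) (simp add: node_diff power_int_minus divide_simps)
    also have "\<dots> = (\<Prod>j\<in>J m. c * (1 - 1 / c * q powi j) * (1 - a / c * q powi j))"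
      by (simp only: prod.distrib neg[of "\<lambda>j. 1 - 1 / c * q powi j"])
    finally show ?thesis
      unfolding prod_dividef[symmetric] mult.assoc mult_divide_mult_cancel_left[OF nz(2)] .
  qed
  moreover have "(\<lambda>m. \<Prod>j\<in>J m. ((1 - d / c * q powi j) * (1 - a / (c * d) * q powi j)) /
                   ((1 - 1 / c * q powi j) * (1 - a / c * q powi j)))
      \<longlonglongrightarrow> theta (d / c) * theta (a / (c * d)) / (theta (1 / c) * theta (a / c))"
    unfolding J_def using nz off off_c by (intro window_quotient_tendsto) auto
  ultimately have "(node a d - node a c) * (infsum ?t UNIV * (lX * lY)) =
      theta (d / c) * theta (a / (c * d)) / (theta (1 / c) * theta (a / c))"
    using lim1 LIMSEQ_unique by auto
  moreover have lXY: "lX * lY = theta d * theta (a / d) / (qpoch_inf q q ^ 2 * theta a)"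
    by (simp add: lX_def lY_def theta_def power2_eq_square mult_ac)
  have "lX * lY \<noteq> 0"
    unfolding lXY using qq theta_nonzero off by simp
  ultimately have "(node a d - node a c) * infsum ?t UNIV =
      theta (d / c) * theta (a / (c * d)) / (theta (1 / c) * theta (a / c)) / (lX * lY)"
    by (simp only: nonzero_eq_divide_eq mult.assoc not_False_eq_True)
  then show ?thesis
    unfolding lXY by (simp add: mult_ac)
qed

end

section \<open>Exchanging poles\<close>

context nome
begin

text \<open>
  The zeros \<open>\<beta>\<close> and the two families of poles \<open>\<gamma>\<close>, \<open>\<delta>\<close> are sequences of nodes of which the first
  \<open>N\<close>, \<open>K\<close> and \<open>L\<close> are used.  The sums considered below all have \<open>K + L = N + 2\<close>, which makes the
  terms decay geometrically in both directions.
\<close>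

definition wp_term ::
  "complex \<Rightarrow> (nat \<Rightarrow> complex) \<Rightarrow> (nat \<Rightarrow> complex) \<Rightarrow> (nat \<Rightarrow> complex) \<Rightarrow> nat \<Rightarrow> nat \<Rightarrow> nat \<Rightarrow> int \<Rightarrow> complex"
  where "wp_term a \<beta> \<gamma> \<delta> N K L n =
    weight a n * (\<Prod>j<N. point a n - \<beta> j) /
      ((\<Prod>i<K. point a n - \<gamma> i) * (\<Prod>j<L. point a n - \<delta> j))"

lemma wp_term_swap: "wp_term a \<beta> \<gamma> \<delta> N K L = wp_term a \<beta> \<delta> \<gamma> N L K"
  by (rule ext) (simp add: wp_term_def mult.commute)

lemma partial_fraction_exchange:
  fixes u :: "'a :: field"
  assumes "u - g \<noteq> 0" "u - d \<noteq> 0" "g - d \<noteq> 0"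
  shows "(u - b) / ((u - g) * (u - d)) = ((b - d) / (u - d) + (g - b) / (u - g)) / (g - d)"
  using assms by (simp add: divide_simps) (simp add: algebra_simps)

lemma wp_term_exchange:
  assumes "\<And>n. point a n - \<gamma> K \<noteq> 0" "\<And>n. point a n - \<delta> L \<noteq> 0" "\<gamma> K - \<delta> L \<noteq> 0"
    and "(wp_term a \<beta> \<gamma> \<delta> N K (Suc L) has_sum S) UNIV"
    and "(wp_term a \<beta> \<gamma> \<delta> N (Suc K) L has_sum T) UNIV"
  shows "(wp_term a \<beta> \<gamma> \<delta> (Suc N) (Suc K) (Suc L) has_sum
           ((\<beta> N - \<delta> L) * S + (\<gamma> K - \<beta> N) * T) / (\<gamma> K - \<delta> L)) UNIV"
proof -
  have "wp_term a \<beta> \<gamma> \<delta> (Suc N) (Suc K) (Suc L) n =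
      ((\<beta> N - \<delta> L) * wp_term a \<beta> \<gamma> \<delta> N K (Suc L) n +
       (\<gamma> K - \<beta> N) * wp_term a \<beta> \<gamma> \<delta> N (Suc K) L n) * (1 / (\<gamma> K - \<delta> L))" for n
  proof -
    define u where "u = point a n"
    define R where "R = weight a n * (\<Prod>j<N. u - \<beta> j) / ((\<Prod>i<K. u - \<gamma> i) * (\<Prod>j<L. u - \<delta> j))"
    have "wp_term a \<beta> \<gamma> \<delta> (Suc N) (Suc K) (Suc L) n =
          R * ((u - \<beta> N) / ((u - \<gamma> K) * (u - \<delta> L)))"
      by (simp add: wp_term_def R_def u_def mult_ac)
    also have "\<dots> = ((\<beta> N - \<delta> L) * (R / (u - \<delta> L)) + (\<gamma> K - \<beta> N) * (R / (u - \<gamma> K))) * (1 / (\<gamma> K - \<delta> L))"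
    proof -
      have "R * ((p / s + r / t) / z) = (p * (R / s) + r * (R / t)) * (1 / z)" for p r s t z
        by (simp add: distrib_left add_divide_distrib mult_ac)
      then show ?thesis
        unfolding partial_fraction_exchange[OF assms(1)[of n, folded u_def] assms(2)[of n, folded u_def] assms(3)] .
    qed
    finally show ?thesis
      by (simp add: wp_term_def R_def u_def mult_ac)
  qed
  then have eq: "wp_term a \<beta> \<gamma> \<delta> (Suc N) (Suc K) (Suc L) = (\<lambda>n.
      ((\<beta> N - \<delta> L) * wp_term a \<beta> \<gamma> \<delta> N K (Suc L) n +
       (\<gamma> K - \<beta> N) * wp_term a \<beta> \<gamma> \<delta> N (Suc K) L n) * (1 / (\<gamma> K - \<delta> L)))"
    by (rule ext)
  show ?thesis
    unfolding eq
    using has_sum_cmult_left[OF has_sum_add[OF has_sum_cmult_right[OF assms(4), of "\<beta> N - \<delta> L"]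
        has_sum_cmult_right[OF assms(5), of "\<gamma> K - \<beta> N"]], of "1 / (\<gamma> K - \<delta> L)"]
    by simp
qed

text \<open>
  Exchanging a zero against one of two poles of the same family reduces everything to the case of
  two poles.
\<close>

lemma wp_term_one_family_sum_0:
  assumes "\<And>n i. point a n - \<gamma> i \<noteq> 0" "\<And>i j. i < j \<Longrightarrow> \<gamma> i \<noteq> \<gamma> j"
    and pair: "\<And>i j. i < j \<Longrightarrow>
      ((\<lambda>n. weight a n / ((point a n - \<gamma> i) * (point a n - \<gamma> j))) has_sum 0) UNIV"
  shows "(wp_term a \<beta> \<gamma> \<delta> N (N + 2) 0 has_sum 0) UNIV"
  using assms
proof (induction N arbitrary: \<gamma>)
  case 0
  have "wp_term a \<beta> \<gamma> \<delta> 0 (0 + 2) 0 = (\<lambda>n. weight a n / ((point a n - \<gamma> 0) * (point a n - \<gamma> 1)))"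
    by (simp add: wp_term_def fun_eq_iff numeral_2_eq_2)
  then show ?case using 0(3)[of 0 1] by simp
next
  case (Suc N)
  \<comment> \<open>Dropping the last pole or the first one leaves \<open>N + 2\<close> poles either way; the family
    constantly equal to \<open>\<gamma> 0\<close> plays the part of the second one.\<close>
  define g where "g i = \<gamma> (Suc i)" for i
  have split: "wp_term a \<beta> \<gamma> (\<lambda>_. \<gamma> 0) M (Suc K) 0 = wp_term a \<beta> g (\<lambda>_. \<gamma> 0) M K (Suc 0)" for M K
    unfolding wp_term_def fun_eq_iff prod.lessThan_Suc_shift by (simp add: g_def mult_ac)
  have "(wp_term a \<beta> g (\<lambda>_. \<gamma> 0) (Suc N) (Suc (Suc N)) (Suc 0) has_sum
      ((\<beta> N - \<gamma> 0) * 0 + (g (Suc N) - \<beta> N) * 0) / (g (Suc N) - \<gamma> 0)) UNIV"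
  proof (rule wp_term_exchange[where \<delta> = "\<lambda>_. \<gamma> 0"])
    have "(wp_term a \<beta> g \<delta> N (N + 2) 0 has_sum 0) UNIV"
      unfolding g_def by (rule Suc.IH; rule Suc.prems; simp)
    then show "(wp_term a \<beta> g (\<lambda>_. \<gamma> 0) N (Suc (Suc N)) 0 has_sum 0) UNIV"
      by (simp add: wp_term_def[abs_def])
    have "(wp_term a \<beta> \<gamma> \<delta> N (N + 2) 0 has_sum 0) UNIV"
      by (rule Suc.IH; rule Suc.prems; simp)
    then have "(wp_term a \<beta> \<gamma> (\<lambda>_. \<gamma> 0) N (Suc (Suc N)) 0 has_sum 0) UNIV"
      by (simp add: wp_term_def[abs_def])
    then show "(wp_term a \<beta> g (\<lambda>_. \<gamma> 0) N (Suc N) (Suc 0) has_sum 0) UNIV"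
      unfolding split .
    show "g (Suc N) - \<gamma> 0 \<noteq> 0"
      using Suc.prems(2)[of 0 "Suc (Suc N)"] by (auto simp: g_def)
  qed (unfold g_def, (rule Suc.prems)+)
  then show ?case
    by (simp add: split[symmetric]) (simp add: wp_term_def[abs_def])
qed

text \<open>
  The index is shifted by one: the zeros are at \<open>w = b / q, \<dots>, b / q^N\<close>.
\<close>

definition beta_node :: "complex \<Rightarrow> complex \<Rightarrow> nat \<Rightarrow> complex" where
  "beta_node a b j = node a (b / q ^ Suc j)"

definition gamma_node :: "complex \<Rightarrow> complex \<Rightarrow> nat \<Rightarrow> complex" where
  "gamma_node a c i = node a (c * q ^ i)"

lemma point_ne_gamma_node:
  assumes "c \<noteq> 0" "off_lattice c" "off_lattice (a / c)"
  shows "point a n - gamma_node a c i \<noteq> 0"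
proof -
  have "off_lattice (a / (c * q ^ i))"
    using assms(3) off_lattice_shift[of "a / c" "- int i"] by (simp add: power_int_minus divide_simps)
  moreover have "off_lattice (c * q ^ i)"
    using assms(2) off_lattice_shift[of c "int i"] by simp
  ultimately show ?thesis
    unfolding gamma_node_def using assms by (intro point_ne_node) auto
qed

lemma gamma_node_ne:
  assumes "a \<noteq> 0" "c \<noteq> 0" "d \<noteq> 0" "off_lattice (c / d)" "off_lattice (c * d / a)"
  shows "gamma_node a c i - gamma_node a d j \<noteq> 0"
proof -
  have "1 - d / c * q powi (int j - int i) \<noteq> 0" "1 - a / (c * d) * q powi (- int i - int j) \<noteq> 0"
    using assms(4,5) off_lattice_inverse[of "c / d"] off_lattice_inverse[of "c * d / a"]
    by (intro off_lattice_factor(1); simp)+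
  moreover have "gamma_node a c i - gamma_node a d j =
      c * q ^ i * (1 - d / c * q powi (int j - int i)) * (1 - a / (c * d) * q powi (- int i - int j))"
    unfolding gamma_node_def using assms
    by (subst node_diff) (auto simp: power_int_diff power_int_minus field_simps)
  ultimately show ?thesis
    using assms by auto
qed

lemma gamma_node_ne_same:
  assumes "a \<noteq> 0" "c \<noteq> 0" "off_lattice (c * c / a)" "i < j"
  shows "gamma_node a c i \<noteq> gamma_node a c j"
proof -
  have "q ^ (j - i) \<noteq> 1"
    using assms q_less_1 power_less_one_iff[of "norm q" "j - i"]
    by (metis less_irrefl norm_ge_zero norm_one norm_power zero_less_diff)
  moreover have "1 - a / (c * c) * q powi (- int i - int j) \<noteq> 0"
    using assms(3) off_lattice_inverse[of "c * c / a"]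
    by (intro off_lattice_factor(1)) simp
  moreover have "gamma_node a c i - gamma_node a c j =
      c * q ^ i * (1 - q ^ (j - i)) * (1 - a / (c * c) * q powi (- int i - int j))"
    unfolding gamma_node_def using assms
    by (subst node_diff) (auto simp: power_int_diff power_int_minus field_simps power_diff)
  ultimately show ?thesis
    using assms by auto
qed

text \<open>
  Two poles at \<open>c q^i\<close> and \<open>c q^j\<close> give a vanishing sum because their theta quotient contains the
  factor \<open>theta (q^(j - i)) = 0\<close>.
\<close>

lemma one_family_sum_0:
  assumes nz: "a \<noteq> 0" "c \<noteq> 0" and off: "off_lattice a" "off_lattice c" "off_lattice (a / c)"
    "off_lattice (c * c / a)"
  shows "(wp_term a \<beta> (gamma_node a c) \<delta> N (N + 2) 0 has_sum 0) UNIV"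
proof (rule wp_term_one_family_sum_0)
  fix i j :: nat assume ij: "i < j"
  have off_i: "off_lattice (c * q ^ i)" "off_lattice (a / (c * q ^ i))" for i
    using off off_lattice_shift[of c "int i"] off_lattice_shift[of "a / c" "- int i"]
    by (simp_all add: power_int_minus divide_simps)
  let ?t = "\<lambda>n. weight a n / ((point a n - gamma_node a c i) * (point a n - gamma_node a c j))"
  have summ: "(\<lambda>n. norm (?t n)) summable_on UNIV"
    unfolding gamma_node_def using nz off off_i by (intro kernel_summable) auto
  have "c * q ^ j / (c * q ^ i) = q ^ (j - i)"
    using nz ij by (simp add: power_diff)
  then have "(gamma_node a c j - gamma_node a c i) * infsum ?t UNIV = 0"
    using kernel_sum[of a "c * q ^ i" "c * q ^ j"] nz off off_i
    by (simp add: gamma_node_def theta_power_eq_0)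
  then have "infsum ?t UNIV = 0"
    using gamma_node_ne_same[OF nz off(4) ij] by simp
  then show "(?t has_sum 0) UNIV"
    using has_sum_infsum[OF abs_summable_summable[OF summ]] by simp
qed (use assms point_ne_gamma_node gamma_node_ne_same in auto)

text \<open>
  Summing the residues at the poles \<open>\<gamma>\<close> gives a balanced terminating very-well-poised
  \<open>\<^sub>8\<phi>\<^sub>7\<close> series, and this product is its value by Jackson's formula.  Its zeros in \<open>b\<close> are the
  values for which the zeros of the summand cancel all poles of one family.
\<close>

definition jackson_coeff :: "complex \<Rightarrow> complex \<Rightarrow> complex \<Rightarrow> complex \<Rightarrow> nat \<Rightarrow> nat \<Rightarrow> complex" where
  "jackson_coeff a b c d k l =
     qfac q (k + l) / (qfac q k * qfac q l) *
     (qfac (c * q ^ Suc k / b) l * qfac (a * q / (b * c)) l *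
      (qfac (d * q ^ Suc l / b) k * qfac (a * q / (b * d)) k)) /
     (qfac (c * d * q / a) (k + l) * (qfac (d * q / c) l * qfac (c * q / d) k)) *
     ((b * d / a) ^ l * (b * c / a) ^ k / q ^ (k * l))"

text \<open>
  What remains of the recurrence for \<open>jackson_coeff\<close> after cancellation, with \<open>X = q^(k+1)\<close> and
  \<open>Y = q^(l+1)\<close>; the parameter \<open>a\<close> has dropped out.
\<close>

lemma jackson_three_term:
  fixes b c d X Y :: complex
  assumes "b \<noteq> 0" "c \<noteq> 0" "d \<noteq> 0" "X \<noteq> 0" "Y \<noteq> 0"
  shows "- (b * c / Y) * (1 - d * Y / (c * X)) * (1 - X * Y) * (1 - c * X * Y / b) * (1 - d * X * Y / b) =
    (b * d / X) * (1 - d * X * Y ^ 2 / b) * (1 - c * X / b) * (1 - X) * (1 - c * X / d) -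
    (b * c / Y) * (1 - c * X ^ 2 * Y / b) * (1 - d * Y / b) * (1 - Y) * (1 - d * Y / c)"
  using assms by (simp add: divide_simps) (simp add: algebra_simps power2_eq_square)

lemma power_q_ne_1: "1 - q ^ Suc n \<noteq> 0"
proof
  assume "1 - q ^ Suc n = 0"
  then have "norm q ^ Suc n = 1"
    by (metis eq_iff_diff_eq_0 norm_one norm_power)
  then show False
    using power_Suc_less_one[of "norm q" n] q_pos q_less_1 by simp
qed

text \<open>
  Each of the three differences of nodes splits into two linear factors.  One of them cancels
  against a factor of the coefficient that it multiplies, or else completes a product that is
  common to all three terms.
\<close>

lemma jackson_coeff_recurrence:
  assumes nz: "a \<noteq> 0" "b \<noteq> 0" "c \<noteq> 0" "d \<noteq> 0"
    and off: "off_lattice (c / d)" "off_lattice (c * d / a)"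
  shows "(gamma_node a c (Suc k) - gamma_node a d (Suc l)) * jackson_coeff a b c d (Suc k) (Suc l) =
    (beta_node a b (Suc (k + l)) - gamma_node a d (Suc l)) * jackson_coeff a b c d k (Suc l) +
    (gamma_node a c (Suc k) - beta_node a b (Suc (k + l))) * jackson_coeff a b c d (Suc k) l"
proof -
  define X Y where "X = q ^ Suc k" and "Y = q ^ Suc l"
  define H where "H = qfac q (Suc (k + l)) / (qfac q k * qfac q l) *
     (qfac (c * q ^ Suc (Suc k) / b) l * qfac (a * q / (b * c)) l *
      (qfac (d * q ^ Suc (Suc l) / b) k * qfac (a * q / (b * d)) k)) /
     (qfac (c * d * q / a) (Suc (k + l)) * (qfac (d * q / c) l * qfac (c * q / d) k)) *
     ((b * d / a) ^ l * (b * c / a) ^ k / q ^ (k * l))"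
  define f1 f2 e where "f1 = 1 - a * Y / (b * c)" and "f2 = 1 - a * X / (b * d)" and "e = 1 - c * d * (X * Y) / a"
  define x y u v where "x = 1 - X" and "y = 1 - Y" and "u = 1 - c * X / d" and "v = 1 - d * Y / c"
  have XY: "X \<noteq> 0" "Y \<noteq> 0" "q * q ^ k = X" "q * q ^ l = Y" "q * (q * q ^ (k + l)) = X * Y"
    by (simp_all add: X_def Y_def power_add)
  have qk: "q ^ k = X / q" "q ^ l = Y / q" "q ^ (k + l) = X * Y / (q * q)"
    by (simp_all add: X_def Y_def power_add)
  have off_inv: "off_lattice (d / c)"
    using off off_lattice_inverse[of "c / d"] by simp
  have ne: "x \<noteq> 0" "y \<noteq> 0" "u \<noteq> 0" "v \<noteq> 0" "e \<noteq> 0"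
    using power_q_ne_1 off_lattice_factor(2)[OF off(1), of "Suc k"]
      off_lattice_factor(2)[OF off_inv, of "Suc l"] off_lattice_factor(2)[OF off(2), of "Suc (Suc (k + l))"]
    by (simp_all only: x_def y_def u_def v_def e_def X_def Y_def times_divide_eq_left not_False_eq_True
          power_add[symmetric] add_Suc add_Suc_right)
  have W11: "jackson_coeff a b c d (Suc k) (Suc l) =
      H * ((1 - X * Y) / (x * y)) * ((1 - c * (X * Y) / b) * f1 * ((1 - d * (X * Y) / b) * f2)) /
        (e * (v * u)) * ((b * d / a) * (b * c / a) * (q / (X * Y)))"
    unfolding jackson_coeff_def H_def f1_def f2_def e_def x_def y_def u_def v_def
    by (simp add: qfac_Suc XY power_add qk mult_ac)
  have W01: "jackson_coeff a b c d k (Suc l) =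
      H / y * ((1 - c * X / b) * f1) / v * ((b * d / a) * (q / X))"
    unfolding jackson_coeff_def H_def f1_def y_def v_def qfac_Suc'[of "c * q ^ Suc k / b"]
    by (simp add: qfac_Suc XY power_add qk mult_ac)
  have W10: "jackson_coeff a b c d (Suc k) l =
      H / x * ((1 - d * Y / b) * f2) / u * ((b * c / a) * (q / Y))"
    unfolding jackson_coeff_def H_def f2_def x_def u_def qfac_Suc'[of "d * q ^ Suc l / b"]
    by (simp add: qfac_Suc XY power_add qk mult_ac)
  have cd: "gamma_node a c (Suc k) - gamma_node a d (Suc l) = - (a / (d * Y)) * (1 - d * Y / (c * X)) * e"
    unfolding gamma_node_def X_def[symmetric] Y_def[symmetric] e_def using nz XY(1,2)
    by (simp add: node_diff) (simp add: field_simps)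
  have bd: "beta_node a b (Suc (k + l)) - gamma_node a d (Suc l) = b / (X * Y) * (1 - d * X * Y ^ 2 / b) * f2"
    unfolding gamma_node_def beta_node_def Y_def[symmetric] f2_def using nz XY(1,2)
    by (simp add: node_diff XY(5)) (simp add: field_simps power2_eq_square)
  have cb: "gamma_node a c (Suc k) - beta_node a b (Suc (k + l)) = - (b / (X * Y)) * (1 - c * X ^ 2 * Y / b) * f1"
    unfolding gamma_node_def beta_node_def X_def[symmetric] f1_def using nz XY(1,2)
    by (simp add: node_diff XY(5)) (simp add: field_simps power2_eq_square)
  define C where "C = H * f1 * f2 * (b * q / (a * (X * Y)))"
  have L: "(gamma_node a c (Suc k) - gamma_node a d (Suc l)) * jackson_coeff a b c d (Suc k) (Suc l) =
     C * (- (b * c / Y) * (1 - d * Y / (c * X)) * (1 - X * Y) * (1 - c * X * Y / b) * (1 - d * X * Y / b))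
       / (x * y * v * u)"
    unfolding cd W11 C_def using ne(5) nz XY(1,2) by (simp add: mult_ac)
  have R1: "(beta_node a b (Suc (k + l)) - gamma_node a d (Suc l)) * jackson_coeff a b c d k (Suc l) =
     C * ((b * d / X) * (1 - d * X * Y ^ 2 / b) * (1 - c * X / b)) / (y * v)"
    unfolding bd W01 C_def by (simp add: mult_ac)
  have R2: "(gamma_node a c (Suc k) - beta_node a b (Suc (k + l))) * jackson_coeff a b c d (Suc k) l =
     - (C * ((b * c / Y) * (1 - c * X ^ 2 * Y / b) * (1 - d * Y / b)) / (x * u))"
    unfolding cb W10 C_def by (simp add: mult_ac)
  have "C * (T2 * x * u - T3 * y * v) / (x * y * v * u) = C * T2 / (y * v) + - (C * T3 / (x * u))" for T2 T3
    using ne by (simp add: field_simps)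
  then show ?thesis
    unfolding L R1 R2 jackson_three_term[OF nz(2-4) XY(1,2)] x_def[symmetric] y_def[symmetric] u_def[symmetric] v_def[symmetric] .
qed

end

section \<open>The rational summand in closed form\<close>

context nome
begin

lemma qfac_nonzero:
  assumes "\<And>j. 1 - x * q ^ j \<noteq> 0"
  shows "qfac x n \<noteq> 0"
  using assms by (simp add: qfac_def)

lemma qfac_q_nonzero: "qfac q n \<noteq> 0"
  using power_q_ne_1 by (intro qfac_nonzero) simp

lemma jackson_coeff_swap: "jackson_coeff a b c d k l = jackson_coeff a b d c l k"
  by (simp add: jackson_coeff_def add.commute[of k l] mult_ac)

text \<open>
  The recurrence at \<open>k = 0\<close>, where the term with one pole \<open>\<gamma>\<close> fewer has a vanishing sum.
\<close>

lemma jackson_coeff_boundary: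
  assumes nz: "a \<noteq> 0" "b \<noteq> 0" "c \<noteq> 0" "d \<noteq> 0"
    and off: "off_lattice (c / d)" "off_lattice (c * d / a)"
  shows "(gamma_node a c 0 - gamma_node a d (Suc l)) * jackson_coeff a b c d 0 (Suc l) =
         (gamma_node a c 0 - beta_node a b l) * jackson_coeff a b c d 0 l"
proof -
  define Y where "Y = q ^ Suc l"
  have Y: "Y \<noteq> 0" "q * q ^ l = Y"
    by (simp_all add: Y_def)
  define v e where "v = 1 - d * Y / c" and "e = 1 - c * d * Y / a"
  have off_inv: "off_lattice (d / c)"
    using off off_lattice_inverse[of "c / d"] by simp
  have ne: "v \<noteq> 0" "e \<noteq> 0"
    using off_lattice_factor(2)[OF off_inv, of "Suc l"] off_lattice_factor(2)[OF off(2), of "Suc l"]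
    by (simp_all only: v_def e_def Y_def times_divide_eq_left not_False_eq_True)
  define H where "H = jackson_coeff a b c d 0 l"
  have W: "jackson_coeff a b c d 0 (Suc l) =
      H * ((1 - c * Y / b) * (1 - a * Y / (b * c))) / (e * v) * (b * d / a)"
    unfolding H_def jackson_coeff_def e_def v_def add_0 qfac_Suc[of "c * q ^ Suc 0 / b"]
      qfac_Suc[of "a * q / (b * c)"] qfac_Suc[of "d * q / c"] qfac_Suc[of "c * d * q / a"]
    using qfac_q_nonzero[of l] qfac_q_nonzero[of "Suc l"]
    by (simp add: Y mult_ac)
  have cd: "gamma_node a c 0 - gamma_node a d (Suc l) = - (a / (d * Y)) * v * e"
    unfolding gamma_node_def Y_def[symmetric] e_def v_def using nz Y(1)
    by (simp add: node_diff) (simp add: field_simps)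
  have cb: "gamma_node a c 0 - beta_node a b l = - (b / Y) * (1 - c * Y / b) * (1 - a * Y / (b * c))"
    unfolding gamma_node_def beta_node_def Y_def[symmetric] using nz Y(1)
    by (simp add: node_diff) (simp add: field_simps power2_eq_square)
  show ?thesis
    unfolding W cd cb H_def[symmetric] using ne nz Y(1) by (simp add: divide_simps)
qed

text \<open>
  Induction on the number of zeros.  Removing the last zero together with the last \<open>\<gamma>\<close> or the last
  \<open>\<delta>\<close> leads to sums of the same kind with unchanged \<open>b\<close>, \<open>c\<close>, \<open>d\<close>, or to a sum over a single family.
\<close>

theorem well_poised_sum:
  assumes nz: "a \<noteq> 0" "b \<noteq> 0" "c \<noteq> 0" "d \<noteq> 0"
    and off: "off_lattice a" "off_lattice c" "off_lattice (a / c)" "off_lattice d" "off_lattice (a / d)"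
    and off2: "off_lattice (c / d)" "off_lattice (c * d / a)" "off_lattice (c * c / a)" "off_lattice (d * d / a)"
  shows "(wp_term a (beta_node a b) (gamma_node a c) (gamma_node a d) (k + l) (Suc k) (Suc l) has_sum
           jackson_coeff a b c d k l *
           (\<Sum>\<^sub>\<infinity>n. weight a n / ((point a n - node a c) * (point a n - node a d)))) UNIV"
    (is "(?T (k + l) (Suc k) (Suc l) has_sum ?W k l * ?S) UNIV")
proof (induction "k + l" arbitrary: k l)
  case 0
  then have "k = 0" "l = 0" by auto
  moreover have "?T 0 (Suc 0) (Suc 0) = (\<lambda>n. weight a n / ((point a n - node a c) * (point a n - node a d)))"
    by (simp add: wp_term_def gamma_node_def fun_eq_iff)
  moreover have "?W 0 0 = 1"
    by (simp add: jackson_coeff_def)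
  ultimately show ?case
    using has_sum_infsum[OF abs_summable_summable[OF kernel_summable[OF nz(1,3,4) off(2-5)]]] by simp
next
  case (Suc N)
  have ne: "point a n - gamma_node a c i \<noteq> 0" "point a n - gamma_node a d i \<noteq> 0"
    "gamma_node a c i - gamma_node a d j \<noteq> 0" for n i j
    using nz off off2 by (simp_all only: point_ne_gamma_node gamma_node_ne not_False_eq_True)
  have zero_c: "(?T M (M + 2) 0 has_sum 0) UNIV" for M
    using nz off off2 by (intro one_family_sum_0)
  have zero_d: "(?T M 0 (M + 2) has_sum 0) UNIV" for M
    using nz off off2 by (subst wp_term_swap) (intro one_family_sum_0)
  consider l' where "k = 0" "l = Suc l'" | k' where "k = Suc k'" "l = 0"
    | k' l' where "k = Suc k'" "l = Suc l'"
    using Suc(2) by (cases k; cases l) auto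
  then show ?case
  proof cases
    case 1
    have "(?T (Suc l') (Suc 0) (Suc (Suc l')) has_sum
        ((beta_node a b l' - gamma_node a d (Suc l')) * 0 +
         (gamma_node a c 0 - beta_node a b l') * (?W 0 l' * ?S)) /
        (gamma_node a c 0 - gamma_node a d (Suc l'))) UNIV"
    proof (rule wp_term_exchange)
      show "(?T l' 0 (Suc (Suc l')) has_sum 0) UNIV"
        using zero_d[of l'] by simp
      show "(?T l' (Suc 0) (Suc l') has_sum ?W 0 l' * ?S) UNIV"
        using Suc(1)[of 0 l'] Suc(2) 1 by simp
    qed (rule ne)+
    moreover have "((gamma_node a c 0 - beta_node a b l') * (?W 0 l' * ?S)) /
        (gamma_node a c 0 - gamma_node a d (Suc l')) = ?W 0 (Suc l') * ?S"
      using jackson_coeff_boundary[OF nz off2(1,2), of l'] ne(3)[of 0 "Suc l'"]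
      by (simp add: divide_simps) (metis mult.assoc mult.commute)
    ultimately show ?thesis using 1 by simp
  next
    case 2
    have "(?T (Suc k') (Suc (Suc k')) (Suc 0) has_sum
        ((beta_node a b k' - gamma_node a d 0) * (?W k' 0 * ?S) +
         (gamma_node a c (Suc k') - beta_node a b k') * 0) /
        (gamma_node a c (Suc k') - gamma_node a d 0)) UNIV"
    proof (rule wp_term_exchange)
      show "(?T k' (Suc (Suc k')) 0 has_sum 0) UNIV"
        using zero_c[of k'] by simp
      show "(?T k' (Suc k') (Suc 0) has_sum ?W k' 0 * ?S) UNIV"
        using Suc(1)[of k' 0] Suc(2) 2 by simp
    qed (rule ne)+
    moreover have "off_lattice (d / c)" "off_lattice (d * c / a)"
      using off2 off_lattice_inverse[of "c / d"] by (simp_all add: mult.commute)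
    from jackson_coeff_boundary[OF nz(1,2,4,3) this, of k']
    have "(gamma_node a c (Suc k') - gamma_node a d 0) * ?W (Suc k') 0 =
          (beta_node a b k' - gamma_node a d 0) * ?W k' 0"
      unfolding jackson_coeff_swap[of a b d c] by (simp add: algebra_simps)
    then have "((beta_node a b k' - gamma_node a d 0) * (?W k' 0 * ?S)) /
        (gamma_node a c (Suc k') - gamma_node a d 0) = ?W (Suc k') 0 * ?S"
      using ne(3)[of "Suc k'" 0] by (simp add: divide_simps) (metis mult.assoc mult.commute)
    ultimately show ?thesis using 2 by simp
  next
    case 3
    have "(?T (Suc (Suc (k' + l'))) (Suc (Suc k')) (Suc (Suc l')) has_sum
        ((beta_node a b (Suc (k' + l')) - gamma_node a d (Suc l')) * (?W k' (Suc l') * ?S) +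
         (gamma_node a c (Suc k') - beta_node a b (Suc (k' + l'))) * (?W (Suc k') l' * ?S)) /
        (gamma_node a c (Suc k') - gamma_node a d (Suc l'))) UNIV"
    proof (rule wp_term_exchange)
      show "(?T (Suc (k' + l')) (Suc k') (Suc (Suc l')) has_sum ?W k' (Suc l') * ?S) UNIV"
        using Suc(1)[of k' "Suc l'"] Suc(2) 3 by simp
      show "(?T (Suc (k' + l')) (Suc (Suc k')) (Suc l') has_sum ?W (Suc k') l' * ?S) UNIV"
        using Suc(1)[of "Suc k'" l'] Suc(2) 3 by simp
    qed (rule ne)+
    moreover have "((beta_node a b (Suc (k' + l')) - gamma_node a d (Suc l')) * (?W k' (Suc l') * ?S) +
         (gamma_node a c (Suc k') - beta_node a b (Suc (k' + l'))) * (?W (Suc k') l' * ?S)) =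
       (gamma_node a c (Suc k') - gamma_node a d (Suc l')) * (?W (Suc k') (Suc l') * ?S)"
      unfolding mult.assoc[symmetric] jackson_coeff_recurrence[OF nz off2(1,2)] distrib_right ..
    ultimately show ?thesis
      using 3 ne(3)[of "Suc k'" "Suc l'"] by simp
  qed
qed

lemma qpoch_nonzero:
  assumes "off_lattice y"
  shows "qpoch y q n \<noteq> 0"
  using off_lattice_factor(1)[OF assms] by (simp add: qpoch_def)

lemma qpoch_step:
  assumes "off_lattice y"
  shows "qpoch y q n * (1 - y * q powi n) = (1 - y) * qpoch (y * q) q n"
proof -
  have yq: "off_lattice (y * q)"
    using assms off_lattice_shift[of y 1] by simp
  define Q where "Q = qpoch_inf (y * q powi n * q) q"
  have "off_lattice (y * q powi n * q)"
    using yq off_lattice_shift[of "y * q" n] by (simp add: mult_ac)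
  then have Q: "Q \<noteq> 0"
    unfolding Q_def by (intro qpoch_inf_nonzero off_lattice_factor)
  have "qpoch_inf y q = qpoch y q n * ((1 - y * q powi n) * Q)"
    using qpoch_inf_eq_qpoch_mult[OF q_pos q_less_1, of n y] off_lattice_factor(1)[OF assms]
      qpoch_inf_head[of "y * q powi n"] by (simp add: Q_def)
  moreover have "qpoch_inf (y * q) q = qpoch (y * q) q n * Q"
    using qpoch_inf_eq_qpoch_mult[OF q_pos q_less_1, of n "y * q"] off_lattice_factor(1)[OF yq]
    by (simp add: Q_def mult_ac)
  ultimately show ?thesis
    using qpoch_inf_head[of y] Q by simp
qed

text \<open>
  Raising \<open>r\<close> by one moves two of the parameters by one step, and each step contributes one
  linear factor in \<open>q^n\<close> relative to its value at \<open>n = 0\<close>.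
\<close>

lemma qpoch_pair_ratio_numerator:
  assumes "b \<noteq> 0" and off: "off_lattice b" "off_lattice (a / b)"
  shows "qpoch b q n * qpoch (a * q ^ Suc r / b) q n / (qpoch (a * q / b) q n * qpoch (b / q ^ r) q n) =
    (q powi n) ^ r * (\<Prod>j<r. point a n - beta_node a b j) / (\<Prod>j<r. point a 0 - beta_node a b j)"
proof (induction r)
  case 0
  have "off_lattice (a * q / b)"
    using off off_lattice_shift[of "a / b" 1] by simp
  then show ?case using qpoch_nonzero off by simp
next
  case (Suc r)
  define x where "x = q powi n"
  define y z where "y = a * q ^ Suc r / b" and "z = b / q ^ Suc r"
  have offs: "off_lattice y" "off_lattice z"
    using off off_lattice_shift[of "a / b" "int (Suc r)"] off_lattice_shift[of b "- int (Suc r)"]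
    by (simp_all add: y_def z_def power_int_minus divide_simps del: of_nat_Suc power_Suc)
  have e: "a * q ^ Suc (Suc r) / b = y * q" "b / q ^ r = z * q"
    by (simp_all add: y_def z_def)
  have pt: "point a m - beta_node a b r = q powi (- m) * (1 - z * q powi m) * (1 - y * q powi m)" for m
    unfolding beta_node_def z_def[symmetric] using assms(1)
    by (subst point_minus_node) (simp_all add: z_def y_def)
  have sy: "qpoch (y * q) q n = qpoch y q n * (1 - y * x) / (1 - y)"
    using qpoch_step[OF offs(1), of n] off_lattice_factor(3)[OF offs(1)] by (simp add: x_def field_simps)
  have sz: "qpoch z q n = qpoch (z * q) q n * (1 - z) / (1 - z * x)"
    using qpoch_step[OF offs(2), of n] off_lattice_factor(1)[OF offs(2), of n] by (simp add: x_def field_simps)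
  have "qpoch b q n * qpoch (y * q) q n / (qpoch (a * q / b) q n * qpoch z q n) =
        (qpoch b q n * qpoch y q n / (qpoch (a * q / b) q n * qpoch (z * q) q n)) *
        ((1 - z * x) * (1 - y * x) / ((1 - z) * (1 - y)))"
    unfolding sy sz by (simp add: mult_ac)
  also have "(1 - z * x) * (1 - y * x) / ((1 - z) * (1 - y)) =
             x * (point a n - beta_node a b r) / (point a 0 - beta_node a b r)"
    unfolding pt x_def by (simp add: power_int_minus)
  also note Suc[folded y_def, unfolded e(2), folded x_def]
  finally show ?case
    unfolding e(1) z_def[symmetric] x_def[symmetric] by (simp add: mult_ac)
qed

text \<open>
  This is the reciprocal of the previous quotient with \<open>b = c q^m\<close>; the nodes are then met in
  reverse order.
\<close>

lemma qpoch_pair_ratio_denominator: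
  assumes "c \<noteq> 0" and off: "off_lattice c" "off_lattice (a / c)"
  shows "qpoch c q n * qpoch (a * q / (c * q ^ m)) q n / (qpoch (a * q / c) q n * qpoch (c * q ^ m) q n) =
    (\<Prod>i<m. point a 0 - gamma_node a c i) / ((q powi n) ^ m * (\<Prod>i<m. point a n - gamma_node a c i))"
proof -
  define b where "b = c * q ^ m"
  have b: "b \<noteq> 0" "off_lattice b" "off_lattice (a / b)"
    using assms off_lattice_shift[of c "int m"] off_lattice_shift[of "a / c" "- int m"]
    by (simp_all add: b_def power_int_minus divide_simps)
  have e: "a * q ^ Suc m / b = a * q / c" "b / q ^ m = c"
    using assms by (simp_all add: b_def)
  have "beta_node a b j = gamma_node a c (m - Suc j)" if "j < m" for j
  proof -
    have "q ^ m = q ^ (m - Suc j) * q ^ Suc j"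
      using that by (simp only: power_add[symmetric]) simp
    then show ?thesis
      by (simp add: beta_node_def gamma_node_def b_def)
  qed
  then have "(\<Prod>j<m. point a p - beta_node a b j) = (\<Prod>j<m. point a p - gamma_node a c (m - Suc j))" for p
    by (intro prod.cong) auto
  then have rev: "(\<Prod>j<m. point a p - beta_node a b j) = (\<Prod>j<m. point a p - gamma_node a c j)" for p
    using prod.nat_diff_reindex[of "\<lambda>j. point a p - gamma_node a c j" m] by simp
  have inv: "A * B / (C * D) = inverse (D * C / (B * A))" for A B C D :: complex
    by (simp add: mult.commute)
  show ?thesis
    using qpoch_pair_ratio_numerator[OF b, of n m] unfolding e rev b_def[symmetric]
    by (subst inv) (simp add: mult_ac)
qed

end

section \<open>The summand of the series as a rational function\<close>

context nome
begin

text \<open>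
  The quotient contributed by the two upper parameters \<open>b\<close>, \<open>a q^(1-m) / b\<close> and their lower
  partners.  It is a polynomial in the node variable for \<open>m \<le> 0\<close> and the reciprocal of one for
  \<open>m \<ge> 0\<close>, up to a power of \<open>q^n\<close>.  This covers the three pairs of the series, with \<open>m\<close> equal to
  \<open>-N\<close>, \<open>1 + k\<close> and \<open>N + 1 - k\<close>.
\<close>

definition pair_ratio :: "complex \<Rightarrow> complex \<Rightarrow> int \<Rightarrow> int \<Rightarrow> complex" where
  "pair_ratio a b m n = qpoch b q n * qpoch (a * q powi (1 - m) / b) q n /
     (qpoch (a * q / b) q n * qpoch (b * q powi m) q n)"

lemma pair_ratio_nonpos:
  assumes "b \<noteq> 0" "off_lattice b" "off_lattice (a / b)"
  shows "pair_ratio a b (- int r) n =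
    (q powi n) ^ r * (\<Prod>j<r. point a n - beta_node a b j) / (\<Prod>j<r. point a 0 - beta_node a b j)"
proof -
  have "q powi (1 - - int r) = q ^ Suc r" "b * q powi (- int r) = b / q ^ r"
    by (simp_all add: power_int_add power_int_minus divide_simps)
  then show ?thesis
    using qpoch_pair_ratio_numerator[OF assms, of n r] by (simp only: pair_ratio_def)
qed

lemma pair_ratio_nonneg:
  assumes "c \<noteq> 0" "off_lattice c" "off_lattice (a / c)"
  shows "pair_ratio a c (int m) n =
    (\<Prod>i<m. point a 0 - gamma_node a c i) / ((q powi n) ^ m * (\<Prod>i<m. point a n - gamma_node a c i))"
proof -
  have "a * q powi (1 - int m) / c = a * q / (c * q ^ m)" "c * q powi (int m) = c * q ^ m"
    by (simp_all add: power_int_diff)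
  then show ?thesis
    using qpoch_pair_ratio_denominator[OF assms, of n m] by (simp only: pair_ratio_def)
qed

lemma psi_term_pair_ratios:
  fixes k :: int and N :: nat
  assumes sa: "sa ^ 2 = a" "off_lattice a" and nz: "a \<noteq> 0" "c \<noteq> 0" "d \<noteq> 0"
  shows "psi_term [q * sa, - q * sa, b, c, d * q powi k, a * q powi (-k) / c,
                   a * q powi (1 + int N) / b, a * q powi (- int N) / d]
                  [sa, - sa, a * q / b, a * q / c, a * q powi (1 - k) / d, c * q powi (1 + k),
                   b * q powi (- int N), d * q powi (1 + int N)] q q n =
         q powi n * weight a n / weight a 0 * pair_ratio a b (- int N) n * pair_ratio a c (1 + k) n *
           pair_ratio a (d * q powi k) (int N + 1 - k) n * q powi n"
proof -
  have off: "off_lattice sa" "off_lattice (- sa)"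
  proof -
    have "x \<noteq> q powi n" if "x ^ 2 = a" for x n
    proof
      assume "x = q powi n"
      then have "a = q powi (n * 2)"
        using that by (simp add: power_int_power')
      then show False using sa(2) by (auto simp: off_lattice_def)
    qed
    then show "off_lattice sa" "off_lattice (- sa)"
      using sa(1) by (auto simp: off_lattice_def)
  qed
  define x where "x = q powi n"
  have step: "qpoch (q * y) q n = qpoch y q n * (1 - y * x) / (1 - y)" if "off_lattice y" for y
    using qpoch_step[OF that, of n] off_lattice_factor(3)[OF that]
    by (simp add: x_def field_simps)
  have "qpoch (q * sa) q n * qpoch (- q * sa) q n / (qpoch sa q n * qpoch (- sa) q n) =
        ((1 - sa * x) * (1 - (- sa) * x)) / ((1 - sa) * (1 - (- sa)))"
    using step[OF off(1)] step[OF off(2)] qpoch_nonzero[OF off(1), of n] qpoch_nonzero[OF off(2), of n]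
    by simp
  also have "(1 - sa * x) * (1 - (- sa) * x) = 1 - a * x ^ 2"
    using sa(1) by (simp add: algebra_simps power2_eq_square)
  also have "(1 - sa) * (1 - (- sa)) = 1 - a"
    using sa(1) by (simp add: algebra_simps power2_eq_square)
  also have "(1 - a * x ^ 2) / (1 - a) = x * weight a n / weight a 0"
    by (simp add: weight_def x_def power_int_minus algebra_simps power2_eq_square)
  finally have first: "qpoch (q * sa) q n * qpoch (- q * sa) q n / (qpoch sa q n * qpoch (- sa) q n) =
      x * weight a n / weight a 0" .
  have args: "a * q powi (1 - - int N) / b = a * q powi (1 + int N) / b"
    "a * q powi (1 - (1 + k)) / c = a * q powi (- k) / c"
    "a * q powi (1 - (int N + 1 - k)) / (d * q powi k) = a * q powi (- int N) / d"
    "a * q / (d * q powi k) = a * q powi (1 - k) / d"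
    "d * q powi k * q powi (int N + 1 - k) = d * q powi (1 + int N)"
    by (simp_all add: power_int_add power_int_diff power_int_minus divide_simps)
  have regroup: "(A1 * (A2 * (A3 * (A4 * (A5 * (A6 * (A7 * A8))))))) / (B1 * (B2 * (B3 * (B4 * (B5 * (B6 * (B7 * B8))))))) * y =
     (A1 * A2 / (B1 * B2)) * (A3 * A7 / (B3 * B7)) * (A4 * A6 / (B4 * B6)) * (A5 * A8 / (B5 * B8)) * y"
    for A1 A2 A3 A4 A5 A6 A7 A8 B1 B2 B3 B4 B5 B6 B7 B8 y :: complex
    by (simp add: mult_ac)
  show ?thesis
    unfolding psi_term_def qpochs_def pair_ratio_def args x_def[symmetric] list.map prod_list.Cons
      prod_list.Nil mult_1_right regroup first ..
qed

lemma pair_ratios_eq_wp_term: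
  assumes "N + 2 = K + L"
  shows "q powi n * weight a n / weight a 0 *
     ((q powi n) ^ N * (\<Prod>j<N. point a n - \<beta> j) / (\<Prod>j<N. point a 0 - \<beta> j)) *
     ((\<Prod>i<K. point a 0 - \<gamma> i) / ((q powi n) ^ K * (\<Prod>i<K. point a n - \<gamma> i))) *
     ((\<Prod>i<L. point a 0 - \<delta> i) / ((q powi n) ^ L * (\<Prod>i<L. point a n - \<delta> i))) * q powi n =
     wp_term a \<beta> \<gamma> \<delta> N K L n / wp_term a \<beta> \<gamma> \<delta> N K L 0"
proof -
  define x where "x = q powi n"
  have x: "x \<noteq> 0" by (simp add: x_def)
  have "x * x * x ^ N = x ^ K * x ^ L"
    using arg_cong[OF assms, of "\<lambda>m. x ^ m"] by (simp add: power_add mult_ac power2_eq_square)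
  then have one: "x * x * x ^ N / (x ^ K * x ^ L) = 1"
    using x by simp
  have "x * w / w0 * (x ^ N * B / B0) * (G0 / (x ^ K * G)) * (D0 / (x ^ L * D)) * x =
     (x * x * x ^ N / (x ^ K * x ^ L)) * ((w * B / (G * D)) / (w0 * B0 / (G0 * D0)))"
    for w w0 B B0 G G0 D D0
    by (simp add: mult_ac)
  note this[unfolded one mult_1_left]
  then show ?thesis
    unfolding wp_term_def x_def[symmetric] .
qed

lemma prod_append_families:
  "(\<Prod>j<N + (r::nat). h (if j < N then f j else g (j - N))) = (\<Prod>j<N. h (f j)) * (\<Prod>j<r. h (g j) :: complex)"
  by (induction r) (simp_all add: mult_ac)

lemma psi_term_eq_wp_term:
  assumes sa: "sa ^ 2 = a" and nz: "a \<noteq> 0" "b \<noteq> 0" "c \<noteq> 0" "d \<noteq> 0"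
    and off: "off_lattice a" "off_lattice b" "off_lattice (a / b)" "off_lattice c" "off_lattice (a / c)"
      "off_lattice d" "off_lattice (a / d)"
    and kl: "k = int k'" "N = k' + l"
  shows "psi_term [q * sa, - q * sa, b, c, d * q powi k, a * q powi (-k) / c,
                   a * q powi (1 + int N) / b, a * q powi (- int N) / d]
                  [sa, - sa, a * q / b, a * q / c, a * q powi (1 - k) / d, c * q powi (1 + k),
                   b * q powi (- int N), d * q powi (1 + int N)] q q n =
         wp_term a (beta_node a b) (gamma_node a c) (gamma_node a (d * q ^ k')) (k' + l) (Suc k') (Suc l) n /
         wp_term a (beta_node a b) (gamma_node a c) (gamma_node a (d * q ^ k')) (k' + l) (Suc k') (Suc l) 0"
proof -
  have D: "d * q ^ k' \<noteq> 0" "off_lattice (d * q ^ k')" "off_lattice (a / (d * q ^ k'))"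
    using nz off off_lattice_shift[of d "int k'"] off_lattice_shift[of "a / d" "- int k'"]
    by (simp_all add: power_int_minus divide_simps)
  have e: "1 + k = int (Suc k')" "int N + 1 - k = int (Suc l)" "d * q powi k = d * q ^ k'"
    using kl by simp_all
  show ?thesis
    unfolding psi_term_pair_ratios[OF sa off(1) nz(1,3,4)]
    unfolding e
      pair_ratio_nonpos[OF nz(2) off(2,3)] pair_ratio_nonneg[OF nz(3) off(4,5)] pair_ratio_nonneg[OF D]
    unfolding kl(2) by (rule pair_ratios_eq_wp_term) simp
qed

text \<open>
  For \<open>k < 0\<close> the parameter \<open>c\<close> contributes zeros instead of poles, and for \<open>k > N\<close> the parameter \<open>d\<close>
  does.  All poles then belong to one family.
\<close>

lemma psi_sum_outside_0:
  assumes sa: "sa ^ 2 = a" and nz: "a \<noteq> 0" "b \<noteq> 0" "c \<noteq> 0" "d \<noteq> 0"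
    and off: "off_lattice a" "off_lattice b" "off_lattice (a / b)" "off_lattice c" "off_lattice (a / c)"
      "off_lattice d" "off_lattice (a / d)" "off_lattice (c * c / a)" "off_lattice (d * d / a)"
    and k: "k < 0 \<or> k > int N"
  shows "(psi_term [q * sa, - q * sa, b, c, d * q powi k, a * q powi (-k) / c,
                   a * q powi (1 + int N) / b, a * q powi (- int N) / d]
                  [sa, - sa, a * q / b, a * q / c, a * q powi (1 - k) / d, c * q powi (1 + k),
                   b * q powi (- int N), d * q powi (1 + int N)] q q has_sum 0) UNIV"
    (is "(?T has_sum 0) UNIV")
proof -
  define D where "D = d * q powi k"
  have "q powi (k + k) = q powi k * q powi k"
    by (rule power_int_add) simp
  then have DD: "D * D / a = (d * d / a) * q powi (k + k)"
    by (simp only: D_def times_divide_eq_left times_divide_eq_right mult_ac)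
  have D: "D \<noteq> 0" "off_lattice D" "off_lattice (a / D)" "off_lattice (D * D / a)"
  proof -
    show "off_lattice (a / D)"
      using off(7) off_lattice_shift[of "a / d" "- k"] nz
      by (simp add: D_def power_int_minus divide_simps)
    show "off_lattice (D * D / a)"
      unfolding DD off_lattice_shift by (rule off)
  qed (use nz off in \<open>simp_all add: D_def off_lattice_shift\<close>)
  define \<beta> where "\<beta> e j = (if j < N then beta_node a b j else beta_node a e (j - N))" for e j
  have one: "q powi n * weight a n / weight a 0 * pair_ratio a b (- int N) n * pair_ratio a e (- int r) n *
           pair_ratio a f (int (N + r + 2)) n * q powi n =
        wp_term a (\<beta> e) (gamma_node a f) (gamma_node a f) (N + r) (N + r + 2) 0 n /
        wp_term a (\<beta> e) (gamma_node a f) (gamma_node a f) (N + r) (N + r + 2) 0 0"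
    if "e \<noteq> 0" "off_lattice e" "off_lattice (a / e)" "f \<noteq> 0" "off_lattice f" "off_lattice (a / f)"
    for e f r n
  proof -
    have "pair_ratio a b (- int N) n * pair_ratio a e (- int r) n =
      (q powi n) ^ (N + r) * (\<Prod>j<N + r. point a n - \<beta> e j) / (\<Prod>j<N + r. point a 0 - \<beta> e j)"
      unfolding \<beta>_def prod_append_families[of "\<lambda>w. point a _ - w"]
        pair_ratio_nonpos[OF nz(2) off(2,3)] pair_ratio_nonpos[OF that(1-3)]
      by (simp add: power_add)
    then show ?thesis
      using pair_ratios_eq_wp_term[of "N + r" "N + r + 2" 0 n a "\<beta> e" "gamma_node a f" "gamma_node a f"]
      unfolding pair_ratio_nonneg[OF that(4-6)] by (simp add: mult_ac)
  qed
  have zero: "((\<lambda>n. wp_term a \<beta>' (gamma_node a f) (gamma_node a f) M (M + 2) 0 n / w) has_sum 0) UNIV"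
    if "f \<noteq> 0" "off_lattice f" "off_lattice (a / f)" "off_lattice (f * f / a)" for f M \<beta>' w
    using has_sum_cmult_left[OF one_family_sum_0[OF nz(1) that(1) off(1) that(2-4)], of \<beta>' "gamma_node a f" M "1 / w"]
    by simp
  show ?thesis
  proof (cases "k < 0")
    case True
    define r where "r = nat (- 1 - k)"
    have e: "1 + k = - int r" "int N + 1 - k = int (N + r + 2)"
      using True by (simp_all add: r_def)
    have "?T = (\<lambda>n. wp_term a (\<beta> c) (gamma_node a D) (gamma_node a D) (N + r) (N + r + 2) 0 n /
        wp_term a (\<beta> c) (gamma_node a D) (gamma_node a D) (N + r) (N + r + 2) 0 0)"
      using one[OF nz(3) off(4,5) D(1-3), of _ r]
      unfolding psi_term_pair_ratios[OF sa off(1) nz(1,3,4)] unfolding e D_def[symmetric] by (intro ext)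
    then show ?thesis
      using zero[OF D] by simp
  next
    case False
    define r where "r = nat (k - int N - 1)"
    have e: "1 + k = int (N + r + 2)" "int N + 1 - k = - int r"
      using False k by (simp_all add: r_def)
    have swap: "x * B * C * E * y = x * B * E * C * y" for x B C E y :: complex
      by simp
    have "?T = (\<lambda>n. wp_term a (\<beta> D) (gamma_node a c) (gamma_node a c) (N + r) (N + r + 2) 0 n /
        wp_term a (\<beta> D) (gamma_node a c) (gamma_node a c) (N + r) (N + r + 2) 0 0)"
      using one[OF D(1-3) nz(3) off(4,5), of _ r]
      unfolding psi_term_pair_ratios[OF sa off(1) nz(1,3,4)] unfolding e D_def[symmetric] 
      by (intro ext) (subst swap)
    then show ?thesis
      using zero[OF nz(3) off(4,5,8)] by simp
  qed
qed

end

section \<open>Agreement with the product side\<close>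

context nome
begin

text \<open>
  The monomial by which a product of factors \<open>1 - x / q^j\<close>, \<open>1 \<le> j \<le> m\<close>, differs from the shifted
  factorial of \<open>q / x\<close>.
\<close>

definition rev_factor :: "complex \<Rightarrow> nat \<Rightarrow> complex" where
  "rev_factor x m = (\<Prod>j<m. - x / q ^ Suc j)"

lemma rev_factor_nonzero: "x \<noteq> 0 \<Longrightarrow> rev_factor x m \<noteq> 0"
  by (simp add: rev_factor_def)

lemma prod_reversed:
  assumes "x \<noteq> 0"
  shows "(\<Prod>j<m. 1 - x / q ^ Suc j) = qfac (q / x) m * rev_factor x m"
  unfolding qfac_def rev_factor_def prod.distrib[symmetric]
  using assms by (intro prod.cong) (simp_all add: field_simps)

lemma qfac_reversed:
  assumes "x \<noteq> 0"
  shows "qfac (x / q ^ m) m = qfac (q / x) m * rev_factor x m"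
proof -
  have "qfac (x / q ^ m) m = (\<Prod>j<m. 1 - x / q ^ m * q ^ (m - Suc j))"
    using prod.nat_diff_reindex[of "\<lambda>j. 1 - x / q ^ m * q ^ j" m] by (simp add: qfac_def)
  also have "\<dots> = (\<Prod>j<m. 1 - x / q ^ Suc j)"
  proof (rule prod.cong[OF refl])
    fix j assume "j \<in> {..<m}"
    then have "q ^ m = q ^ (m - Suc j) * q ^ Suc j"
      by (simp only: power_add[symmetric]) simp
    then show "1 - x / q ^ m * q ^ (m - Suc j) = 1 - x / q ^ Suc j"
      by simp
  qed
  finally show ?thesis
    using prod_reversed[OF assms] by simp
qed

lemma rev_factor_balanced:
  assumes "x * y = z * w"
  shows "rev_factor x m * rev_factor y m = rev_factor z m * rev_factor w m"
  unfolding rev_factor_def prod.distrib[symmetric] using assms by (intro prod.cong) auto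

lemma rev_factor_add: "rev_factor x (k + l) * q ^ (k * l) = rev_factor x k * rev_factor x l"
proof (induction l)
  case (Suc l)
  have "rev_factor x (k + Suc l) * q ^ (k * Suc l) =
        (rev_factor x (k + l) * q ^ (k * l)) * (- x / q ^ Suc (k + l) * q ^ k)"
    by (simp add: rev_factor_def power_add mult_ac)
  also have "- x / q ^ Suc (k + l) * q ^ k = - x / q ^ Suc l"
    by (simp add: power_add)
  finally show ?case
    by (simp add: Suc) (simp add: rev_factor_def)
qed (simp add: rev_factor_def)

lemma rev_factor_scale: "rev_factor (x * y) m = x ^ m * rev_factor y m"
  by (induction m) (simp_all add: rev_factor_def mult_ac)

lemma rev_factor_Suc': "rev_factor (x * q) (Suc m) = - x * rev_factor x m"
  unfolding rev_factor_def prod.lessThan_Suc_shift by simp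

lemma qpoch_of_nat: "qpoch x q (int n) = qfac x n"
  unfolding qpoch_def qfac_def
  by (simp, rule prod.reindex_bij_witness[of _ int nat]) (auto simp: power_int_def)

text \<open>
  Replacing \<open>d\<close> by \<open>d q\<close> multiplies numerator and denominator by the same factor \<open>a / (d\<^sup>2 q)\<close>.
\<close>

lemma theta_quotient_shift:
  assumes nz: "a \<noteq> 0" "c \<noteq> 0" "d \<noteq> 0" and off: "off_lattice d" "off_lattice (a / d)"
  shows "theta (d * q ^ k / c) * theta (a / (c * (d * q ^ k))) / (theta (d * q ^ k) * theta (a / (d * q ^ k))) =
         theta (d / c) * theta (a / (c * d)) / (theta d * theta (a / d))"
proof (induction k)
  case (Suc k)
  define e where "e = d * q ^ k"
  have e: "e \<noteq> 0" "off_lattice e" "off_lattice (a / e)"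
    using nz off off_lattice_shift[of d "int k"] off_lattice_shift[of "a / d" "- int k"]
    by (simp_all add: e_def power_int_minus divide_simps)
  have down: "theta (y / q) = - (y / q) * theta y" if "y \<noteq> 0" for y
    using theta_shift[of "y / q"] that by (simp add: field_simps)
  have sh: "d * q ^ Suc k = e * q" and sh': "e * q / c = e / c * q"
    "a / (c * (e * q)) = a / (c * e) / q" "a / (e * q) = a / e / q"
    by (simp_all add: e_def)
  have ne: "theta e \<noteq> 0" "theta (a / e) \<noteq> 0"
    using e by (simp_all add: theta_nonzero)
  have cancel: "(- x / (e / c)) * (- (a / (c * e) / q) * y) / ((- z / e) * (- (a / e / q) * w)) = x * y / (z * w)"
    if "z \<noteq> 0" "w \<noteq> 0" for x y z w
    using that nz e(1) by (simp add: divide_simps)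
  have nz': "e / c \<noteq> 0" "a / (c * e) \<noteq> 0" "a / e \<noteq> 0"
    using nz e by auto
  show ?case
    unfolding sh
    unfolding sh'
    unfolding theta_shift[OF nz'(1)] theta_shift[OF e(1)] down[OF nz'(2)] down[OF nz'(3)] cancel[OF ne]
    by (rule Suc[folded e_def])
qed simp

lemma theta_quotient_heads:
  assumes "a \<noteq> 0" "c \<noteq> 0" "d \<noteq> 0"
  shows "qpoch_inf q q ^ 2 * theta a * theta (d / c) * theta (a / (c * d)) /
           (theta (1 / c) * theta (a / c) * theta d * theta (a / d)) =
         (1 - a) * (1 - d / c) * (1 - a / (c * d)) / ((1 - 1 / c) * (1 - a / c) * (1 - d) * (1 - a / d)) *
         (qpochs_inf [q, q, a * q, q / a, c * d * q / a, a * q / (c * d), c * q / d, d * q / c] q /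
          qpochs_inf [c * q, q / c, d * q, q / d, c * q / a, a * q / c, d * q / a, a * q / d] q)"
  unfolding theta_head qpochs_inf_def by (simp add: power2_eq_square mult_ac)

text \<open>
  The final comparison of \<open>closed_form_matches\<close>, with all shifted factorials treated as unknowns.
  The letters \<open>u\<close> to \<open>z\<close>, \<open>s\<close>, \<open>t\<close> and \<open>o1\<close> stand for single factors \<open>1 - \<dots>\<close>; \<open>m1\<close>, \<open>m6\<close>, \<open>m8\<close>,
  \<open>m10\<close>, \<open>m12\<close>, \<open>m13\<close> and \<open>rb\<close> are monomials from reversed factorials.  The equations \<open>M1\<close> and
  \<open>M2\<close> express that these monomials cancel, and \<open>F11\<close> and \<open>F12\<close> relate the factorials containing
  \<open>c d / a\<close> and \<open>d / c\<close>.
\<close>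

lemma matching_algebra:
  fixes a c d D :: complex
  assumes "u \<noteq> 0" "v \<noteq> 0" "w \<noteq> 0" "x \<noteq> 0" "y \<noteq> 0" "z \<noteq> 0" "s \<noteq> 0" "t \<noteq> 0" "o1 \<noteq> 0"
    "a \<noteq> 0" "c \<noteq> 0" "d \<noteq> 0" "D \<noteq> 0"
    and ne: "A2 \<noteq> 0" "B1 \<noteq> 0" "dk \<noteq> 0" "dak \<noteq> 0" "G1 \<noteq> 0" "m1 \<noteq> 0" "m12 \<noteq> 0" "cdN \<noteq> 0" "cdk2 \<noteq> 0" "dcN \<noteq> 0"
    and M1: "m8 * m10 = m1 * m12" and M2: "mu * m6 * m13 / rb = - (a / D)"
    and F11: "u * (cdN * cdk2) = cdk * (s * H1)" and F12: "v * dcN = J1 * m12 * (z * J2)"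
  shows "(G1 * G2) / (qk * G1) * (B2 * AA * (P2 * E1)) / (H1 * (J2 * J1)) * mu *
      ((o1 * v * (- (a / (c * d)) * u) / ((- (t / c)) * w * x * (- (a / d) * y)) * Ip) /
        (D * (- (c / D) * z) * (- (a / (c * D)) * s))) /
      (o1 * (Q1 * rb * Q2) / ((t * K1 * (w * (K2 * m6))) * (D1 * (D2 * m13)))) =
    (AA * A2 * (B1 * B2) * (dk * D1 / x) * (dak * D2 / y)) / (cdN * dcN * Q1 * Q2) *
    ((cdk * (E1 * m8) * K1 * K2 * P2 * (G2 * m10)) / (qk * B1 * dak * dk * (A2 * m1) * cdk2)) * Ip"
proof -
  define Core where "Core = G2 / qk * B2 * AA * P2 * E1 * K1 * K2 * D1 * D2 / (Q1 * Q2) / (x * y) * Ip"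
  have cdk: "cdk / (cdN * cdk2) = u / (s * H1)"
  proof (cases "H1 = 0")
    case True
    then show ?thesis using F11 assms by auto
  next
    case False
    then show ?thesis using F11 assms by (simp add: frac_eq_eq mult_ac)
  qed
  have dcN: "1 / dcN = v / (J1 * m12 * (z * J2))"
    using F12 assms by (metis (no_types, opaque_lifting) divide_divide_eq_left divide_self mult.commute mult_eq_0_iff)
  have "(G1 * G2) / (qk * G1) * (B2 * AA * (P2 * E1)) / (H1 * (J2 * J1)) * mu *
      ((o1 * v * (- (a / (c * d)) * u) / ((- (t / c)) * w * x * (- (a / d) * y)) * Ip) /
        (D * (- (c / D) * z) * (- (a / (c * D)) * s))) /
      (o1 * (Q1 * rb * Q2) / ((t * K1 * (w * (K2 * m6))) * (D1 * (D2 * m13)))) =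
      Core * (mu * m6 * m13 / rb) * (- (D / a)) * (u / (s * H1)) * (v / (z * J1 * J2))"
    unfolding Core_def using assms(1-13) ne(5) by (simp add: mult_ac)
  also have "\<dots> = Core * (u / (s * H1)) * (v / (z * J1 * J2))"
    unfolding M2 using assms(10,13) by simp
  finally have L: "(G1 * G2) / (qk * G1) * (B2 * AA * (P2 * E1)) / (H1 * (J2 * J1)) * mu *
      ((o1 * v * (- (a / (c * d)) * u) / ((- (t / c)) * w * x * (- (a / d) * y)) * Ip) /
        (D * (- (c / D) * z) * (- (a / (c * D)) * s))) /
      (o1 * (Q1 * rb * Q2) / ((t * K1 * (w * (K2 * m6))) * (D1 * (D2 * m13)))) = \<dots>" .
  have "(AA * A2 * (B1 * B2) * (dk * D1 / x) * (dak * D2 / y)) / (cdN * dcN * Q1 * Q2) *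
    ((cdk * (E1 * m8) * K1 * K2 * P2 * (G2 * m10)) / (qk * B1 * dak * dk * (A2 * m1) * cdk2)) * Ip =
    Core * (cdk / (cdN * cdk2)) * (m8 * m10 / m1) * (1 / dcN)"
    unfolding Core_def using ne by (simp add: mult_ac)
  also have "\<dots> = Core * (u / (s * H1)) * (v / (z * J1 * J2))"
    unfolding cdk dcN M1 using ne by (simp add: mult_ac)
  finally show ?thesis
    unfolding L ..
qed

text \<open>
  With \<open>D = d q^k\<close> every shifted factorial of the product side can be rewritten as one that occurs
  in \<open>jackson_coeff\<close> or in the value of the summand at \<open>n = 0\<close>, up to monomials and single factors.
  By \<open>theta_quotient_shift\<close> the theta products for \<open>d\<close> may be used in place of those for \<open>D\<close>.
\<close>

theorem closed_form_matches:
  fixes k l :: nat and a b c d S :: complex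
  defines "D \<equiv> d * q ^ k" and "N \<equiv> k + l"
  assumes nz: "a \<noteq> 0" "b \<noteq> 0" "c \<noteq> 0" "d \<noteq> 0"
    and off: "off_lattice a" "off_lattice c" "off_lattice (a / c)" "off_lattice d" "off_lattice (a / d)"
      "off_lattice (c / d)" "off_lattice (c * d / a)" "off_lattice (c / b)" "off_lattice (b * c / a)"
    and S: "(node a D - node a c) * S = qpoch_inf q q ^ 2 * theta a * theta (d / c) * theta (a / (c * d)) /
           (theta (1 / c) * theta (a / c) * theta d * theta (a / d))"
  shows "jackson_coeff a b c D k l * S /
      wp_term a (beta_node a b) (gamma_node a c) (gamma_node a D) N (Suc k) (Suc l) 0 =
      qpochs [a * q / (b * c), c * q / b, d * q, d * q / a] q (int N) /
      qpochs [c * d * q / a, d * q / c, q / b, a * q / b] q (int N) *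
      (qpochs [c * d / a, b * d / a, c * q, c * q / a, d * q powi (1 + int N) / b,
               q powi (- int N)] q (int k) /
       qpochs [q, c * q / b, d / a, d, b * c * q powi (- int N) / a,
               c * d * q powi (1 + int N) / a] q (int k)) *
      (qpochs_inf [q, q, a * q, q / a, c * d * q / a, a * q / (c * d), c * q / d, d * q / c] q /
       qpochs_inf [c * q, q / c, d * q, q / d, c * q / a, a * q / c, d * q / a, a * q / d] q)"
proof -
  define Ip where "Ip = qpochs_inf [q, q, a * q, q / a, c * d * q / a, a * q / (c * d), c * q / d, d * q / c] q /
       qpochs_inf [c * q, q / c, d * q, q / d, c * q / a, a * q / c, d * q / a, a * q / d] q"
  have D: "D \<noteq> 0"
    using nz by (simp add: D_def)
  have off': "off_lattice (d / c)" "off_lattice (d / a)" "off_lattice (c * D / a)" "off_lattice (D / c)"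
    "off_lattice (c * q / D)" "off_lattice (c * q / b)" "off_lattice (c * d * q ^ Suc N / a)"
    "off_lattice (b * c / (a * q ^ l))" "off_lattice (a * q / (b * c) * q ^ l)"
    "off_lattice (c * d * q / a)" "off_lattice (d * q / c)"
  proof -
    show 1: "off_lattice (d / c)" "off_lattice (d / a)"
      using off off_lattice_inverse[of "c / d"] off_lattice_inverse[of "a / d"] by simp_all
    show "off_lattice (c * D / a)" "off_lattice (D / c)" "off_lattice (c * d * q ^ Suc N / a)"
      "off_lattice (c * d * q / a)" "off_lattice (d * q / c)" "off_lattice (c * q / b)"
      using off 1 off_lattice_shift[of "c * d / a" "int k"] off_lattice_shift[of "d / c" "int k"]
        off_lattice_shift[of "c * d / a" "int (Suc N)"] off_lattice_shift[of "c * d / a" 1]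
        off_lattice_shift[of "d / c" 1] off_lattice_shift[of "c / b" 1]
      by (simp_all add: D_def mult_ac del: of_nat_Suc)
    show "off_lattice (c * q / D)"
      using off(6) off_lattice_shift[of "c / d" "1 - int k"]
      by (simp add: D_def power_int_diff mult_ac)
    show "off_lattice (b * c / (a * q ^ l))"
      using off(9) off_lattice_shift[of "b * c / a" "- int l"] by (simp add: power_int_minus divide_simps)
    have "a * q / (b * c) * q ^ l = 1 / (b * c / a) * q powi (1 + int l)"
      by (simp add: power_int_add)
    then show "off_lattice (a * q / (b * c) * q ^ l)"
      using off(9) by (simp only: off_lattice_shift off_lattice_inverse)
  qed
  have nzq: "qfac x n \<noteq> 0" if "off_lattice x" for x n
    using that by (intro qfac_nonzero off_lattice_factor)
  have add: "qfac x (k + l) = qfac x k * qfac (x * q ^ k) l" "qfac x (k + l) = qfac x l * qfac (x * q ^ l) k" for x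
    using qfac_add[of x k l] qfac_add[of x l k] by (simp_all add: add.commute)
  have head: "(1 - x) * qfac (x * q) (k + l) = qfac x k * qfac (x * q ^ k) (Suc l)" for x
    using qfac_Suc'[of x "k + l"] qfac_add[of x k "Suc l"] by simp
  note heads = head[of d] head[of "d / a"] head[of "d / c"]

  define u v w x y z s where "u = 1 - c * d / a" and "v = 1 - d / c" and "w = 1 - a / c" and "x = 1 - d"
    and "y = 1 - d / a" and "z = 1 - D / c" and "s = 1 - c * D / a"
  have ne: "u \<noteq> 0" "v \<noteq> 0" "w \<noteq> 0" "x \<noteq> 0" "y \<noteq> 0" "z \<noteq> 0" "s \<noteq> 0" "1 - c \<noteq> 0" "1 - a \<noteq> 0"
    using off off' off_lattice_factor(3)
    by (simp_all only: u_def v_def w_def x_def y_def z_def s_def not_False_eq_True)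

  \<comment> \<open>The factors of the product side in terms of \<open>D\<close>.  A factorial of base \<open>x / q ^ k\<close> is reversed,
    and a product of two adjacent ones is merged and split again at index \<open>k\<close> or \<open>l\<close>.\<close>
  have F1: "qfac (a * q / (b * c)) N = qfac (a * q / (b * c)) l * qfac (a * q / (b * c) * q ^ l) k"
    unfolding N_def by (rule add)
  have qN: "q powi (- int N) = 1 / (q ^ l * q ^ k)"
    by (simp only: power_int_minus_divide power_int_of_nat N_def power_add mult.commute)
  have F1': "qfac (b * c * q powi (- int N) / a) k =
      qfac (a * q / (b * c) * q ^ l) k * rev_factor (b * c / (a * q ^ l)) k"
  proof -
    have "b * c * q powi (- int N) / a = b * c / (a * q ^ l) / q ^ k"
      by (simp add: qN)
    then show ?thesis
      using qfac_reversed[of "b * c / (a * q ^ l)" k] nz by (simp add: mult_ac)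
  qed
  have F2: "qfac (c * q / b) N = qfac (c * q / b) k * qfac (c * q ^ Suc k / b) l"
    unfolding N_def by (simp add: add(1)[of "c * q / b"] mult_ac)
  have F3: "qfac (d * q) N = qfac d k * qfac D (Suc l) / x"
    using heads(1) ne(4) by (simp add: N_def D_def x_def field_simps)
  have F4: "qfac (d * q / a) N = qfac (d / a) k * qfac (D / a) (Suc l) / y"
    using heads(2) ne(5) by (simp add: N_def D_def y_def field_simps)
  have F8: "qfac (b * d / a) k = qfac (a * q / (b * D)) k * rev_factor (b * D / a) k"
    using qfac_reversed[of "b * D / a" k] nz D by (simp add: D_def mult_ac)
  have F9: "d * q powi (1 + int N) / b = D * q ^ Suc l / b"
    by (simp add: D_def N_def power_int_add power_add)
  have F10: "qfac (q powi (- int N)) k = qfac (q * q ^ l) k * rev_factor (1 / q ^ l) k"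
    unfolding qN using qfac_reversed[of "1 / q ^ l" k] by simp
  have F10': "qfac q N = qfac q l * qfac (q * q ^ l) k"
    unfolding N_def by (rule add)
  have F11: "u * (qfac (c * d * q / a) N * qfac (c * d * q powi (1 + int N) / a) k) =
             qfac (c * d / a) k * (s * qfac (c * D * q / a) N)"
  proof -
    have e: "c * d * q powi (1 + int N) / a = c * d / a * q ^ Suc N" "c * d * q / a = c * d / a * q"
      "c * D * q / a = c * D / a * q" "c * d / a * q ^ k = c * D / a"
      by (simp_all add: power_int_add D_def)
    have "u * qfac (c * d / a * q) N * qfac (c * d / a * q ^ Suc N) k = qfac (c * d / a) (Suc N + k)"
      unfolding u_def qfac_Suc'[symmetric] by (rule qfac_add[symmetric])
    also have "Suc N + k = k + Suc N" by simp
    also have "qfac (c * d / a) (k + Suc N) = qfac (c * d / a) k * (s * qfac (c * D / a * q) N)"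
      unfolding qfac_add[of _ k] e qfac_Suc' s_def by (rule refl)
    finally show ?thesis unfolding e by (simp only: mult.assoc)
  qed
  have F12: "v * qfac (d * q / c) N =
      qfac (c * q / D) k * rev_factor (D / c) k * (z * qfac (D * q / c) l)"
  proof -
    have "qfac (d / c) k = qfac (c * q / D) k * rev_factor (D / c) k"
      using qfac_reversed[of "D / c" k] nz D by (simp add: D_def mult_ac)
    moreover have "qfac (d / c * q ^ k) (Suc l) = z * qfac (D * q / c) l"
      unfolding qfac_Suc' z_def by (simp add: D_def)
    ultimately show ?thesis
      using heads(3) by (simp add: v_def N_def)
  qed

  \<comment> \<open>The summand at \<open>n = 0\<close>, by which the series is normalised.\<close>
  have pt: "point a 0 - node a e = (1 - e) * (1 - a / e)" if "e \<noteq> 0" for e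
    using point_minus_node[OF that, of a 0] by simp
  have L1: "(\<Prod>j<N. point a 0 - beta_node a b j) = qfac (q / b) N * rev_factor b N * qfac (a * q / b) N"
  proof -
    have "(\<Prod>j<N. point a 0 - beta_node a b j) = (\<Prod>j<N. (1 - b / q ^ Suc j) * (1 - a * q / b * q ^ j))"
      unfolding beta_node_def using nz by (intro prod.cong) (simp_all add: pt)
    then show ?thesis
      by (simp only: prod.distrib prod_reversed[OF nz(2)] qfac_def[of "a * q / b"])
  qed
  have L2: "(\<Prod>i<Suc k. point a 0 - gamma_node a c i) =
      (1 - c) * qfac (c * q) k * (w * (qfac (c * q / a) k * rev_factor (a / c) k))"
  proof -
    have "(\<Prod>i<Suc k. point a 0 - gamma_node a c i) = (\<Prod>i<Suc k. (1 - c * q ^ i) * (1 - a / (c * q ^ i)))"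
      unfolding gamma_node_def using nz by (intro prod.cong) (simp_all add: pt)
    also have "\<dots> = qfac c (Suc k) * ((1 - a / c) * (\<Prod>i<k. 1 - a / c / q ^ Suc i))"
      by (simp only: prod.distrib qfac_def prod.lessThan_Suc_shift[of "\<lambda>i. 1 - a / (c * q ^ i)"]
            divide_divide_eq_left power_0 mult_1_right o_def)
    finally show ?thesis
      using prod_reversed[of "a / c" k] nz by (simp add: qfac_Suc' w_def mult_ac)
  qed
  have L3: "(\<Prod>i<Suc l. point a 0 - gamma_node a D i) =
      qfac D (Suc l) * (qfac (D / a) (Suc l) * rev_factor (a * q / D) (Suc l))"
  proof -
    have "(\<Prod>i<Suc l. point a 0 - gamma_node a D i) = (\<Prod>i<Suc l. (1 - D * q ^ i) * (1 - a * q / D / q ^ Suc i))"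
      unfolding gamma_node_def using D by (intro prod.cong) (simp_all add: pt)
    then show ?thesis
      using prod_reversed[of "a * q / D" "Suc l"] nz D
      by (simp only: prod.distrib qfac_def[of D]) simp
  qed
  have M1: "rev_factor (b * D / a) k * rev_factor (1 / q ^ l) k =
            rev_factor (b * c / (a * q ^ l)) k * rev_factor (D / c) k"
    by (rule rev_factor_balanced) (use nz in simp)
  have M2: "(b * D / a) ^ l * (b * c / a) ^ k / q ^ (k * l) * rev_factor (a / c) k *
      rev_factor (a * q / D) (Suc l) / rev_factor b N = - (a / D)"
  proof -
    have 1: "(b * D / a) ^ l * rev_factor (a / D) l = rev_factor b l"
      "(b * c / a) ^ k * rev_factor (a / c) k = rev_factor b k"
      unfolding rev_factor_scale[symmetric] using nz D by simp_all
    have 2: "rev_factor (a * q / D) (Suc l) = - (a / D) * rev_factor (a / D) l"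
      using rev_factor_Suc'[of "a / D" l] by simp
    have "(b * D / a) ^ l * (b * c / a) ^ k / q ^ (k * l) * rev_factor (a / c) k *
      rev_factor (a * q / D) (Suc l) / rev_factor b N =
      - (a / D) * (((b * c / a) ^ k * rev_factor (a / c) k) * ((b * D / a) ^ l * rev_factor (a / D) l)) /
        (rev_factor b (k + l) * q ^ (k * l))"
      unfolding 2 N_def by (simp only: times_divide_eq_left times_divide_eq_right divide_divide_eq_left mult_ac)
    also have "\<dots> = - (a / D)"
      unfolding 1 rev_factor_add using rev_factor_nonzero[OF nz(2)] by simp
    finally show ?thesis .
  qed
  have el: "1 - a / (c * d) = - (a / (c * d)) * u" "1 - 1 / c = - ((1 - c) / c)" "1 - a / d = - (a / d) * y"
    "node a D - node a c = D * (- (c / D) * z) * (- (a / (c * D)) * s)"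
    using nz D by (simp_all add: u_def y_def z_def s_def node_diff field_simps)
  have X: "D * (- (c / D) * z) * (- (a / (c * D)) * s) \<noteq> 0"
    using nz D ne by simp
  have S': "S = ((1 - a) * v * (- (a / (c * d)) * u) / ((- ((1 - c) / c)) * w * x * (- (a / d) * y)) * Ip) /
      (D * (- (c / D) * z) * (- (a / (c * D)) * s))"
    by (rule nonzero_eq_divide_eq[THEN iffD2, OF X])
       (rule S[unfolded theta_quotient_heads[OF nz(1,3,4)] Ip_def[symmetric] el
          v_def[symmetric] w_def[symmetric] x_def[symmetric], unfolded mult.commute[of _ S]])
  have J: "jackson_coeff a b c D k l =
     qfac q l * qfac (q * q ^ l) k / (qfac q k * qfac q l) *
     (qfac (c * q ^ Suc k / b) l * qfac (a * q / (b * c)) l *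
      (qfac (D * q ^ Suc l / b) k * qfac (a * q / (b * D)) k)) /
     (qfac (c * D * q / a) N * (qfac (D * q / c) l * qfac (c * q / D) k)) *
     ((b * D / a) ^ l * (b * c / a) ^ k / q ^ (k * l))"
    unfolding jackson_coeff_def N_def[symmetric] F10' ..
  have P: "wp_term a (beta_node a b) (gamma_node a c) (gamma_node a D) N (Suc k) (Suc l) 0 =
      (1 - a) * (qfac (q / b) N * rev_factor b N * qfac (a * q / b) N) /
      ((1 - c) * qfac (c * q) k * (w * (qfac (c * q / a) k * rev_factor (a / c) k)) *
       (qfac D (Suc l) * (qfac (D / a) (Suc l) * rev_factor (a * q / D) (Suc l))))"
    unfolding wp_term_def L1 L2 L3 by (simp add: weight_def)
  have nz_all: "qfac (a * q / (b * c) * q ^ l) k \<noteq> 0" "qfac (c * q / b) k \<noteq> 0" "qfac d k \<noteq> 0"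
    "qfac (d / a) k \<noteq> 0" "qfac q l \<noteq> 0" "rev_factor (b * c / (a * q ^ l)) k \<noteq> 0" "rev_factor (D / c) k \<noteq> 0"
    "qfac (c * d * q / a) N \<noteq> 0" "qfac (c * d * q powi (1 + int N) / a) k \<noteq> 0" "qfac (d * q / c) N \<noteq> 0"
  proof -
    have "q powi (1 + int N) = q ^ Suc N"
      by (metis power_int_of_nat of_nat_Suc)
    then show "qfac (c * d * q powi (1 + int N) / a) k \<noteq> 0"
      using nzq[OF off'(7)] by simp
  qed (use off off' nzq qfac_q_nonzero nz D rev_factor_nonzero in auto)
  have eq: "qpochs [a * q / (b * c), c * q / b, d * q, d * q / a] q (int N) /
      qpochs [c * d * q / a, d * q / c, q / b, a * q / b] q (int N) *
      (qpochs [c * d / a, b * d / a, c * q, c * q / a, d * q powi (1 + int N) / b,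
               q powi (- int N)] q (int k) /
       qpochs [q, c * q / b, d / a, d, b * c * q powi (- int N) / a,
               c * d * q powi (1 + int N) / a] q (int k)) =
     (qfac (a * q / (b * c)) l * qfac (a * q / (b * c) * q ^ l) k * (qfac (c * q / b) k * qfac (c * q ^ Suc k / b) l) *
       (qfac d k * qfac D (Suc l) / x) * (qfac (d / a) k * qfac (D / a) (Suc l) / y)) /
     (qfac (c * d * q / a) N * qfac (d * q / c) N * qfac (q / b) N * qfac (a * q / b) N) *
     ((qfac (c * d / a) k * (qfac (a * q / (b * D)) k * rev_factor (b * D / a) k) * qfac (c * q) k *
       qfac (c * q / a) k * qfac (D * q ^ Suc l / b) k * (qfac (q * q ^ l) k * rev_factor (1 / q ^ l) k)) /
      (qfac q k * qfac (c * q / b) k * qfac (d / a) k * qfac d k *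
       (qfac (a * q / (b * c) * q ^ l) k * rev_factor (b * c / (a * q ^ l)) k) *
       qfac (c * d * q powi (1 + int N) / a) k))"
    unfolding qpochs_def list.map prod_list.Cons prod_list.Nil mult_1_right qpoch_of_nat
      F9 F1 F1' F2 F3 F4 F8 F10 by (simp only: mult.assoc)
  show ?thesis
    unfolding eq Ip_def[symmetric] J P S'
    by (rule matching_algebra[OF ne nz(1,3,4) D nz_all M1 M2 F11 F12])
qed

end

section \<open>Continuity in the parameters\<close>

text \<open>
  A ratio test that is uniform in a parameter: close to the limit the ratios are bounded by some
  \<open>\<rho> < 1\<close> from an index on that does not depend on the parameter, and the finitely many earlier
  terms are bounded because they converge.
\<close>

lemma geometric_bound_of_ratio:
  fixes T R :: "nat \<Rightarrow> 'i \<Rightarrow> complex"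
  assumes step: "\<forall>\<^sub>F i in F. \<forall>n. T (Suc n) i = T n i * R n i"
    and ratio: "((\<lambda>(n, i). R n i) \<longlongrightarrow> r) (sequentially \<times>\<^sub>F F)" "norm r < 1"
    and lim: "\<And>n. ((\<lambda>i. T n i) \<longlongrightarrow> t n) F"
  obtains C \<rho> where "0 \<le> C" "0 \<le> \<rho>" "\<rho> < 1" "\<forall>\<^sub>F i in F. \<forall>n. norm (T n i) \<le> C * \<rho> ^ n"
proof -
  obtain \<rho> where \<rho>: "norm r < \<rho>" "\<rho> < 1"
    using ratio(2) dense by blast
  then have \<rho>0: "\<rho> > 0"
    using norm_ge_zero[of r] by linarith
  have "\<forall>\<^sub>F x in sequentially \<times>\<^sub>F F. norm ((\<lambda>(n, i). R n i) x) < \<rho>"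
    using tendsto_norm[OF ratio(1)] \<rho>(1) by (rule order_tendstoD)
  then obtain P Q where P: "eventually P sequentially" and Q: "eventually Q F"
    and PQ: "\<And>n i. P n \<Longrightarrow> Q i \<Longrightarrow> norm (R n i) < \<rho>"
    by (auto simp: eventually_prod_filter)
  then obtain n0 where n0: "\<And>n. n \<ge> n0 \<Longrightarrow> P n"
    by (auto simp: eventually_sequentially)
  define B where "B = (\<Sum>n\<le>n0. norm (t n) + 1)"
  have B: "norm (t n) + 1 \<le> B" if "n \<le> n0" for n
    unfolding B_def using that by (intro member_le_sum) auto
  have "\<forall>\<^sub>F i in F. \<forall>n\<in>{..n0}. norm (T n i) < norm (t n) + 1"
    by (intro eventually_ball_finite ballI order_tendstoD(2)[OF tendsto_norm[OF lim]]) auto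
  then have "\<forall>\<^sub>F i in F. \<forall>n. norm (T n i) \<le> B / \<rho> ^ n0 * \<rho> ^ n"
    using step Q
  proof eventually_elim
    case (elim i)
    have small: "norm (T n i) \<le> B" if "n \<le> n0" for n
      using elim(1) B[OF that] that by force
    have large: "norm (T (n0 + m) i) \<le> B * \<rho> ^ m" for m
    proof (induction m)
      case (Suc m)
      have "norm (T (n0 + Suc m) i) = norm (T (n0 + m) i) * norm (R (n0 + m) i)"
        using elim(2) by (simp add: norm_mult)
      also have "\<dots> \<le> B * \<rho> ^ m * \<rho>"
        using Suc PQ[OF n0[of "n0 + m"] elim(3)] by (intro mult_mono) (auto intro: order_trans[OF norm_ge_zero])
      finally show ?case by (simp add: mult_ac)
    qed (use small in simp)
    show ?case
    proof
      fix n
      have B0: "0 \<le> B" using small[of 0] by (meson norm_ge_zero order_trans zero_le)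
      show "norm (T n i) \<le> B / \<rho> ^ n0 * \<rho> ^ n"
      proof (cases "n \<le> n0")
        case True
        have "\<rho> ^ n0 \<le> \<rho> ^ n"
          using \<rho> \<rho>0 True by (intro power_decreasing) auto
        then have "B * 1 \<le> B * (\<rho> ^ n / \<rho> ^ n0)"
          using B0 \<rho>0 by (intro mult_left_mono) auto
        then show ?thesis using small[OF True] by simp
      next
        case False
        then have "\<rho> ^ n = \<rho> ^ n0 * \<rho> ^ (n - n0)"
          by (simp flip: power_add)
        then show ?thesis using large[of "n - n0"] False \<rho>0 by simp
      qed
    qed
  qed
  moreover have "B / \<rho> ^ n0 \<ge> 0"
    using \<rho>0 by (simp add: B_def sum_nonneg)
  ultimately show ?thesis
    using that[of "B / \<rho> ^ n0" \<rho>] \<rho> \<rho>0 by auto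
qed

lemma tendsto_prod_list_map:
  assumes "list_all2 (\<lambda>f x. ((\<lambda>i. h i f) \<longlongrightarrow> g x) F) fs xs"
  shows "((\<lambda>i. \<Prod>f\<leftarrow>fs. h i f) \<longlongrightarrow> (\<Prod>x\<leftarrow>xs. g x :: complex)) F"
  using assms by (induction rule: list_all2_induct) (auto intro: tendsto_mult)

lemma prod_list_inverse: "inverse (\<Prod>x\<leftarrow>xs. h x) = (\<Prod>x\<leftarrow>xs. inverse (h x) :: complex)"
  by (induction xs) auto

lemma prod_list_mult: "(\<Prod>x\<leftarrow>xs. h x * g x) = (\<Prod>x\<leftarrow>xs. h x) * (\<Prod>x\<leftarrow>xs. g x :: complex)"
  by (induction xs) auto

lemma prod_list_const: "(\<Prod>x\<leftarrow>xs. c :: complex) = c ^ length xs"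
  by (induction xs) auto

context nome
begin

lemma qpoch_Suc: "qpoch x q (int (Suc n)) = qpoch x q (int n) * (1 - x * q ^ n)"
  by (simp only: qpoch_of_nat qfac_Suc)

lemma qpoch_neg_Suc: "qpoch x q (- int (Suc n)) = qpoch x q (- int n) * inverse (1 - x / q ^ Suc n)"
proof -
  have *: "qpoch x q (- int m) = (\<Prod>j\<in>{1..int m}. inverse (1 - x * q powi (- j)))" for m
    by (cases "m = 0") (auto simp: qpoch_def)
  have "{1..int (Suc n)} = insert (int (Suc n)) {1..int n}"
    by auto
  then show ?thesis
    unfolding * by (simp add: power_int_minus divide_simps mult_ac del: of_nat_Suc power_Suc)
qed

text \<open>
  For \<open>n < 0\<close> the reciprocal of a lower factorial is a polynomial in its parameter, so the limit
  parameter may be a zero of it; only the upper factorials need nonvanishing factors.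
\<close>

lemma psi_term_tendsto:
  assumes fs: "list_all2 (\<lambda>f x. (f \<longlongrightarrow> x) F) fs xs" and gs: "list_all2 (\<lambda>g y. (g \<longlongrightarrow> y) F) gs ys"
    and defined: "qpochs_quotient_defined xs ys q n"
  shows "((\<lambda>i. psi_term (map (\<lambda>f. f i) fs) (map (\<lambda>g. g i) gs) q z n) \<longlongrightarrow> psi_term xs ys q z n) F"
proof -
  have x: "((\<lambda>i. qpoch (f i) q n) \<longlongrightarrow> qpoch x q n) F" if "(f \<longlongrightarrow> x) F" "x \<in> set xs" for f x
    using that defined unfolding qpoch_def qpochs_quotient_defined_def
    by (auto intro!: tendsto_intros)
  have y: "((\<lambda>i. inverse (qpoch (g i) q n)) \<longlongrightarrow> inverse (qpoch y q n)) F"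
    if "(g \<longlongrightarrow> y) F" "y \<in> set ys" for g y
  proof (cases "n \<ge> 0")
    case True
    then have "qpoch y q n \<noteq> 0"
      using defined that(2) by (simp add: qpoch_def qpochs_quotient_defined_def)
    then show ?thesis
      using that True by (auto simp: qpoch_def intro!: tendsto_intros)
  next
    case False
    then show ?thesis
      using that by (auto simp: qpoch_def simp flip: prod_inversef intro!: tendsto_intros)
  qed
  have "list_all2 (\<lambda>f x. ((\<lambda>i. qpoch (f i) q n) \<longlongrightarrow> qpoch x q n) F) fs xs"
    by (rule list.rel_mono_strong[OF fs]) (use x in blast)
  moreover have "list_all2 (\<lambda>g y. ((\<lambda>i. inverse (qpoch (g i) q n)) \<longlongrightarrow> inverse (qpoch y q n)) F) gs ys"
    by (rule list.rel_mono_strong[OF gs]) (use y in blast)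
  ultimately show ?thesis
    unfolding psi_term_def qpochs_def divide_inverse prod_list_inverse list.map_comp o_def
    by (intro tendsto_intros tendsto_prod_list_map)
qed

text \<open>
  The ratio of consecutive terms tends to \<open>z\<close> in the positive direction and to
  \<open>\<Prod>ys / (\<Prod>xs z)\<close> in the negative direction, locally uniformly in the parameters.
\<close>

theorem psi_tendsto:
  assumes fs: "list_all2 (\<lambda>f x. (f \<longlongrightarrow> x) F) fs xs" and gs: "list_all2 (\<lambda>g y. (g \<longlongrightarrow> y) F) gs ys"
    and F: "F \<noteq> bot" and defined: "psi_defined xs ys q"
    and nz: "0 \<notin> set xs" "0 \<notin> set ys" and len: "length xs = length ys"
    and z: "norm z < 1" "norm (prod_list ys / prod_list xs / z) < 1"
  shows "psi_term xs ys q z summable_on UNIV"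
    and "((\<lambda>i. psi (map (\<lambda>f. f i) fs) (map (\<lambda>g. g i) gs) q z) \<longlongrightarrow> psi xs ys q z) F"
proof -
  define T where "T n i = psi_term (map (\<lambda>f. f i) fs) (map (\<lambda>g. g i) gs) q z n" for n i
  have lim: "((\<lambda>i. T n i) \<longlongrightarrow> psi_term xs ys q z n) F" for n
    unfolding T_def using defined by (intro psi_term_tendsto fs gs) (simp add: psi_defined_def)
  have lens: "length fs = length xs" "length gs = length ys"
    using fs gs by (auto dest: list_all2_lengthD)
  let ?G = "sequentially \<times>\<^sub>F F"
  have q_lim: "((\<lambda>x. q ^ fst x) \<longlongrightarrow> 0) ?G"
    by (rule filterlim_compose[OF power_q_tendsto_0 filterlim_fst])
  have snd_lim: "((\<lambda>x. f (snd x)) \<longlongrightarrow> w) ?G" if "(f \<longlongrightarrow> w) F" for f and w :: complex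
    by (rule filterlim_compose[OF that filterlim_snd])
  have ones: "((\<lambda>x. \<Prod>h\<leftarrow>hs. 1 - h (snd x) * q ^ fst x) \<longlongrightarrow> 1) ?G"
    if "list_all2 (\<lambda>h w. (h \<longlongrightarrow> w) F) hs ws" for hs and ws :: "complex list"
  proof -
    have "((\<lambda>x. 1 - h (snd x) * q ^ fst x) \<longlongrightarrow> 1) ?G" if "(h \<longlongrightarrow> w) F" for h and w :: complex
      using tendsto_diff[OF tendsto_const[of 1] tendsto_mult[OF snd_lim[OF that] q_lim]] by simp
    then have "((\<lambda>x. \<Prod>h\<leftarrow>hs. 1 - h (snd x) * q ^ fst x) \<longlongrightarrow> (\<Prod>w\<leftarrow>ws. 1)) ?G"
      by (intro tendsto_prod_list_map list_all2_mono[OF that])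
    then show ?thesis by (simp add: prod_list_const)
  qed
  have ones': "((\<lambda>x. \<Prod>h\<leftarrow>hs. 1 - q ^ Suc (fst x) / h (snd x)) \<longlongrightarrow> 1) ?G"
    if "list_all2 (\<lambda>h w. (h \<longlongrightarrow> w) F) hs ws" "0 \<notin> set ws" for hs and ws :: "complex list"
  proof -
    have "((\<lambda>x. 1 - q ^ Suc (fst x) / h (snd x)) \<longlongrightarrow> 1) ?G" if "(h \<longlongrightarrow> w) F" "w \<noteq> 0" for h and w :: complex
      using tendsto_diff[OF tendsto_const[of 1] tendsto_divide[OF tendsto_mult[OF tendsto_const[of q] q_lim]
            snd_lim[OF that(1)] that(2)]] by simp
    then have "((\<lambda>x. \<Prod>h\<leftarrow>hs. 1 - q ^ Suc (fst x) / h (snd x)) \<longlongrightarrow> (\<Prod>w\<leftarrow>ws. 1)) ?G"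
      using that(2) by (intro tendsto_prod_list_map list.rel_mono_strong[OF that(1)]) (metis)
    then show ?thesis by (simp add: prod_list_const)
  qed
  have nz_ev: "\<forall>\<^sub>F i in F. \<forall>h\<in>set hs. h i \<noteq> 0"
    if "list_all2 (\<lambda>h w. (h \<longlongrightarrow> w) F) hs ws" "0 \<notin> set ws" for hs and ws :: "complex list"
    using that
  proof (induction rule: list_all2_induct)
    case (Cons h hs w ws)
    then show ?case
      using tendsto_imp_eventually_ne[of h w F 0] by (auto intro: eventually_conj)
  qed simp

  obtain C1 r1 where C1: "0 \<le> C1" "0 \<le> r1" "r1 < 1" "\<forall>\<^sub>F i in F. \<forall>n. norm (T (int n) i) \<le> C1 * r1 ^ n"
  proof (rule geometric_bound_of_ratio)
    show "\<forall>\<^sub>F i in F. \<forall>n. T (int (Suc n)) i =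
        T (int n) i * (z * ((\<Prod>f\<leftarrow>fs. 1 - f i * q ^ n) / (\<Prod>g\<leftarrow>gs. 1 - g i * q ^ n)))"
      unfolding T_def psi_term_def qpochs_def list.map_comp o_def qpoch_Suc prod_list_mult
        power_int_of_nat by (simp add: mult_ac)
    show "((\<lambda>(n, i). z * ((\<Prod>f\<leftarrow>fs. 1 - f i * q ^ n) / (\<Prod>g\<leftarrow>gs. 1 - g i * q ^ n))) \<longlongrightarrow> z * (1 / 1)) ?G"
      unfolding case_prod_unfold by (intro tendsto_intros ones[OF fs] ones[OF gs]) simp
  qed (use z lim in auto)

  define r where "r = prod_list ys / prod_list xs / z"
  obtain C2 r2 where C2: "0 \<le> C2" "0 \<le> r2" "r2 < 1" "\<forall>\<^sub>F i in F. \<forall>n. norm (T (- int n) i) \<le> C2 * r2 ^ n"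
  proof (rule geometric_bound_of_ratio)
    let ?R = "\<lambda>n i. (\<Prod>g\<leftarrow>gs. g i) / (\<Prod>f\<leftarrow>fs. f i) / z *
        ((\<Prod>g\<leftarrow>gs. 1 - q ^ Suc n / g i) / (\<Prod>f\<leftarrow>fs. 1 - q ^ Suc n / f i))"
    show "\<forall>\<^sub>F i in F. \<forall>n. T (- int (Suc n)) i = T (- int n) i * ?R n i"
      using nz_ev[OF fs nz(1)] nz_ev[OF gs nz(2)]
    proof eventually_elim
      case (elim i)
      show ?case
      proof
        fix n
        \<comment> \<open>The powers of \<open>- 1 / q^(n+1)\<close> cancel between the two lists, which have equal length.\<close>
        have flip: "(\<Prod>h\<leftarrow>hs. 1 - h i / q ^ Suc n) =
            (\<Prod>h\<leftarrow>hs. h i) * (\<Prod>h\<leftarrow>hs. 1 - q ^ Suc n / h i) * (- 1 / q ^ Suc n) ^ length hs"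
          if "\<forall>h\<in>set hs. h i \<noteq> 0" for hs
        proof -
          have "(\<Prod>h\<leftarrow>hs. 1 - h i / q ^ Suc n) = (\<Prod>h\<leftarrow>hs. h i * (1 - q ^ Suc n / h i) * (- 1 / q ^ Suc n))"
            using that by (intro arg_cong[of _ _ prod_list] map_cong refl) (simp add: field_simps)
          then show ?thesis by (simp only: prod_list_mult prod_list_const)
        qed
        have "z powi (- int (Suc n)) = z powi (- int n) / z"
          by (simp only: power_int_minus_divide power_int_of_nat power_Suc) simp
        then have "T (- int (Suc n)) i = T (- int n) i *
            ((\<Prod>g\<leftarrow>gs. 1 - g i / q ^ Suc n) / (\<Prod>f\<leftarrow>fs. 1 - f i / q ^ Suc n) / z)"
          unfolding T_def psi_term_def qpochs_def list.map_comp o_def qpoch_neg_Suc prod_list_mult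
          by (simp add: prod_list_inverse[symmetric] divide_inverse mult_ac)
        also have "(\<Prod>g\<leftarrow>gs. 1 - g i / q ^ Suc n) / (\<Prod>f\<leftarrow>fs. 1 - f i / q ^ Suc n) / z = ?R n i"
          unfolding flip[OF elim(1)] flip[OF elim(2)] lens len by simp
        finally show "T (- int (Suc n)) i = T (- int n) i * ?R n i" .
      qed
    qed
    have "prod_list xs \<noteq> 0"
      using nz by (simp add: prod_list_zero_iff)
    then have "((\<lambda>i. (\<Prod>g\<leftarrow>gs. g i) / (\<Prod>f\<leftarrow>fs. f i) / z) \<longlongrightarrow> r) F"
      using tendsto_prod_list_map[of "\<lambda>i f. f i" "\<lambda>x. x" F fs xs] fs
        tendsto_prod_list_map[of "\<lambda>i f. f i" "\<lambda>x. x" F gs ys] gs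
      unfolding r_def divide_inverse by (auto intro!: tendsto_intros)
    from snd_lim[OF this] show "((\<lambda>(n, i). ?R n i) \<longlongrightarrow> r * (1 / 1)) ?G"
      unfolding case_prod_unfold by (intro tendsto_intros ones'[OF fs] ones'[OF gs] nz) simp_all
  qed (use z lim r_def in auto)

  define M where "M n = max C1 C2 * max r1 r2 ^ nat \<bar>n\<bar>" for n
  have M: "M summable_on UNIV"
    by (rule summable_on_int) (use C1 C2 in \<open>auto simp: M_def intro!: summable_mult summable_geometric mult_nonneg_nonneg\<close>)
  have "\<forall>\<^sub>F i in F. \<forall>n. norm (T n i) \<le> M n"
    using C1(4) C2(4)
  proof eventually_elim
    case (elim i)
    show ?case
    proof
      fix n :: int
      have le: "C1 * r1 ^ m \<le> max C1 C2 * max r1 r2 ^ m" "C2 * r2 ^ m \<le> max C1 C2 * max r1 r2 ^ m" for m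
        using C1 C2 by (auto intro!: mult_mono power_mono)
      show "norm (T n i) \<le> M n"
        using elim(1)[rule_format, of "nat n"] elim(2)[rule_format, of "nat (- n)"]
          le(1)[of "nat n"] le(2)[of "nat (- n)"]
        by (cases "n \<ge> 0") (auto simp: M_def)
    qed
  qed
  from tannery_int[OF lim this M F]
  show "psi_term xs ys q z summable_on UNIV"
    and "((\<lambda>i. psi (map (\<lambda>f. f i) fs) (map (\<lambda>g. g i) gs) q z) \<longlongrightarrow> psi xs ys q z) F"
    by (simp_all add: psi_def T_def)
qed

end

section \<open>From generic to arbitrary parameters\<close>

context nome
begin

definition upper_params :: "complex \<Rightarrow> complex \<Rightarrow> complex \<Rightarrow> complex \<Rightarrow> complex \<Rightarrow> int \<Rightarrow> nat \<Rightarrow> complex list" where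
  "upper_params sa a b c d k N = [q * sa, - q * sa, b, c, d * q powi k, a * q powi (-k) / c,
     a * q powi (1 + int N) / b, a * q powi (- int N) / d]"

definition lower_params :: "complex \<Rightarrow> complex \<Rightarrow> complex \<Rightarrow> complex \<Rightarrow> complex \<Rightarrow> int \<Rightarrow> nat \<Rightarrow> complex list" where
  "lower_params sa a b c d k N = [sa, - sa, a * q / b, a * q / c, a * q powi (1 - k) / d,
     c * q powi (1 + k), b * q powi (- int N), d * q powi (1 + int N)]"

definition product_side :: "complex \<Rightarrow> complex \<Rightarrow> complex \<Rightarrow> complex \<Rightarrow> int \<Rightarrow> nat \<Rightarrow> complex" where
  "product_side a b c d k N =
      qpochs [a * q / (b * c), c * q / b, d * q, d * q / a] q (int N) /
      qpochs [c * d * q / a, d * q / c, q / b, a * q / b] q (int N) *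
      (qpochs [c * d / a, b * d / a, c * q, c * q / a, d * q powi (1 + int N) / b,
               q powi (- int N)] q k /
       qpochs [q, c * q / b, d / a, d, b * c * q powi (- int N) / a,
               c * d * q powi (1 + int N) / a] q k) *
      (qpochs_inf [q, q, a * q, q / a, c * d * q / a, a * q / (c * d), c * q / d, d * q / c] q /
       qpochs_inf [c * q, q / c, d * q, q / d, c * q / a, a * q / c, d * q / a, a * q / d] q)"

text \<open>
  The product side contains \<open>(q^(-N); q)\<^sub>k / (q; q)\<^sub>k\<close>, whose denominator has a pole for \<open>k < 0\<close> and
  whose numerator has a zero for \<open>k > N\<close>.
\<close>

lemma product_side_outside_0:
  assumes "k < 0 \<or> k > int N"
  shows "product_side a b c d k N = 0"
proof (cases "k < 0")
  case True
  have "qpoch q q k = 0"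
    using True by (auto simp: qpoch_def power_int_minus intro!: bexI[of _ 1])
  then show ?thesis
    by (simp add: product_side_def qpochs_def)
next
  case False
  then have "qpoch (q powi (- int N)) q k = 0"
    using assms by (auto simp: qpoch_def power_int_minus intro!: bexI[of _ "int N"])
  then show ?thesis
    by (simp add: product_side_def qpochs_def)
qed

theorem psi_generic:
  assumes sa: "sa ^ 2 = a" and nz: "a \<noteq> 0" "b \<noteq> 0" "c \<noteq> 0" "d \<noteq> 0"
    and off: "off_lattice a" "off_lattice b" "off_lattice (a / b)" "off_lattice c" "off_lattice (a / c)"
      "off_lattice d" "off_lattice (a / d)" "off_lattice (c * c / a)" "off_lattice (d * d / a)"
      "off_lattice (c / d)" "off_lattice (c * d / a)" "off_lattice (c / b)" "off_lattice (b * c / a)"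
  shows "psi (upper_params sa a b c d k N) (lower_params sa a b c d k N) q q = product_side a b c d k N"
proof (cases "k < 0 \<or> k > int N")
  case True
  from psi_sum_outside_0[OF sa nz off(1-9) True] show ?thesis
    unfolding psi_def upper_params_def[symmetric] lower_params_def[symmetric] product_side_outside_0[OF True]
    by (rule infsumI)
next
  case False
  then obtain k' l where kl: "k = int k'" "N = k' + l"
    by (metis le_iff_add nonneg_int_cases not_less of_nat_le_iff)
  define D where "D = d * q ^ k'"
  have shift: "off_lattice (x * q ^ k') = off_lattice x" for x
    using off_lattice_shift[of x "int k'"] by simp
  have "c / d = c / D * q ^ k'" "a / d = a / D * q ^ k'"
    by (simp_all add: D_def)
  then have D: "D \<noteq> 0" "off_lattice D" "off_lattice (a / D)" "off_lattice (c / D)"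
    using nz(4) off(6,7,10) shift by (metis D_def mult_eq_0_iff power_eq_0_iff q_nonzero)+
  have "c * D / a = (c * d / a) * q ^ k'" "D * D / a = (d * d / a) * q ^ k' * q ^ k'"
    by (simp_all add: D_def)
  then have D': "off_lattice (c * D / a)" "off_lattice (D * D / a)"
    using off(9,11) shift by metis+
  define S where "S = (\<Sum>\<^sub>\<infinity>n. weight a n / ((point a n - node a c) * (point a n - node a D)))"
  let ?w = "wp_term a (beta_node a b) (gamma_node a c) (gamma_node a D) N (Suc k') (Suc l)"
  have "(node a D - node a c) * S = qpoch_inf q q ^ 2 * theta a * theta (d / c) * theta (a / (c * d)) /
           (theta (1 / c) * theta (a / c) * theta d * theta (a / d))"
  proof -
    have regroup: "p * t1 * t2 * t3 / (t4 * t5 * t6 * t7) = p * t1 / (t4 * t5) * (t2 * t3 / (t6 * t7))"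
      for p t1 t2 t3 t4 t5 t6 t7 :: complex
      by (simp add: mult_ac)
    show ?thesis
      unfolding S_def kernel_sum[OF nz(1,3) D(1) off(1,4,5) D(2,3)] regroup
      unfolding D_def theta_quotient_shift[OF nz(1,3,4) off(6,7)] ..
  qed
  then have match: "jackson_coeff a b c D k' l * S / ?w 0 = product_side a b c d k N"
    unfolding product_side_def kl D_def
    using off by (intro closed_form_matches nz) auto
  have "(?w has_sum jackson_coeff a b c D k' l * S) UNIV"
    unfolding S_def kl(2) using nz off D D' by (intro well_poised_sum)
  from has_sum_cmult_left[OF this, of "1 / ?w 0"]
  have "((\<lambda>n. ?w n / ?w 0) has_sum product_side a b c d k N) UNIV"
    using match by simp
  moreover have "psi_term (upper_params sa a b c d k N) (lower_params sa a b c d k N) q q = (\<lambda>n. ?w n / ?w 0)"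
    unfolding upper_params_def lower_params_def D_def
    using psi_term_eq_wp_term[OF sa nz off(1-7) kl] kl(2) by (intro ext) simp
  ultimately show ?thesis
    by (simp add: psi_def infsumI)
qed

text \<open>
  The absolute value of \<open>w s^p\<close> determines \<open>s > 0\<close>.
\<close>

lemma off_lattice_scaling_countable:
  assumes "p \<noteq> 0" "w \<noteq> 0"
  shows "countable {s::real. s > 0 \<and> \<not> off_lattice (w * of_real s powi p)}"
proof -
  have "{s::real. s > 0 \<and> \<not> off_lattice (w * of_real s powi p)} \<subseteq>
        range (\<lambda>n. (norm q powi n / norm w) powr (1 / of_int p))"
  proof
    fix s :: real assume "s \<in> {s. s > 0 \<and> \<not> off_lattice (w * of_real s powi p)}"
    then obtain n where s: "s > 0" "w * of_real s powi p = q powi n"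
      by (auto simp: off_lattice_def)
    then have "norm w * s powi p = norm q powi n"
      by (metis norm_mult norm_of_real norm_power_int abs_of_pos)
    then have "norm q powi n / norm w = s powr of_int p"
      using assms(2) s(1) by (simp add: powr_real_of_int' field_simps)
    then have "s = (norm q powi n / norm w) powr (1 / of_int p)"
      using s(1) assms(1) by (simp add: powr_powr)
    then show "s \<in> range (\<lambda>n. (norm q powi n / norm w) powr (1 / of_int p))"
      by blast
  qed
  then show ?thesis
    by (rule countable_subset) simp
qed

lemma generic_scaling_sequence:
  assumes "countable I" "\<And>w p. (w, p) \<in> I \<Longrightarrow> w \<noteq> 0 \<and> p \<noteq> (0::int)"
  obtains s :: "nat \<Rightarrow> real" where "s \<longlonglongrightarrow> 1" "\<And>i. s i > 0"
    "\<And>i w p. (w, p) \<in> I \<Longrightarrow> off_lattice (w * of_real (s i) powi p)"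
proof -
  define Bad where "Bad = (\<Union>(w, p)\<in>I. {s::real. s > 0 \<and> \<not> off_lattice (w * of_real s powi p)})"
  have "countable Bad"
    unfolding Bad_def using assms off_lattice_scaling_countable by (intro countable_UN) auto
  have "\<exists>x. x \<in> {1<..<1 + 1 / real (Suc i)} - Bad" for i
  proof -
    \<comment> \<open>An interval cannot be exhausted by the countable bad set.\<close>
    have "uncountable ({1<..<1 + 1 / real (Suc i)} - Bad)"
      using \<open>countable Bad\<close> by (intro uncountable_minus_countable) (auto simp: uncountable_open_interval)
    then show ?thesis
      by (metis countable_empty ex_in_conv)
  qed
  then obtain s where s: "\<And>i. s i \<in> {1<..<1 + 1 / real (Suc i)} - Bad"
    by metis
  have "s \<longlonglongrightarrow> 1"
  proof (rule tendsto_sandwich[of "\<lambda>_. 1" s sequentially "\<lambda>i. 1 + 1 / real (Suc i)"])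
    show "(\<lambda>i. 1 + 1 / real (Suc i)) \<longlonglongrightarrow> 1"
      using tendsto_add[OF tendsto_const[of 1] LIMSEQ_inverse_real_of_nat] by (simp add: inverse_eq_divide)
    show "\<forall>\<^sub>F i in sequentially. 1 \<le> s i" "\<forall>\<^sub>F i in sequentially. s i \<le> 1 + 1 / real (Suc i)"
      using s by (auto intro!: always_eventually less_imp_le)
  qed simp
  moreover have pos: "s i > 0" for i
    using s[of i] by auto
  moreover have "off_lattice (w * of_real (s i) powi p)" if "(w, p) \<in> I" for i w p
    using s[of i] that pos[of i] by (auto simp: Bad_def)
  ultimately show ?thesis
    using that by blast
qed

lemma tendsto_qpoch:
  assumes "(f \<longlongrightarrow> x) F" "k \<ge> 0"
  shows "((\<lambda>i. qpoch (f i) q k) \<longlongrightarrow> qpoch x q k) F"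
  using assms by (auto simp: qpoch_def intro!: tendsto_intros)

lemma qpochs_nonzero_of_defined:
  assumes "qpochs_quotient_defined xs ys q k" "k \<ge> 0"
  shows "qpochs ys q k \<noteq> 0"
  using assms by (auto simp: qpochs_def qpoch_def qpochs_quotient_defined_def prod_list_zero_iff)

lemma product_side_tendsto:
  assumes lim: "(a' \<longlongrightarrow> a) F" "(b' \<longlongrightarrow> b) F" "(c' \<longlongrightarrow> c) F" "(d' \<longlongrightarrow> d) F"
    and nz: "a \<noteq> 0" "b \<noteq> 0" "c \<noteq> 0" "d \<noteq> 0"
    and N_defined: "qpochs [c * d * q / a, d * q / c, q / b, a * q / b] q (int N) \<noteq> 0"
    and k_defined: "k \<ge> 0 \<Longrightarrow> qpochs [q, c * q / b, d / a, d, b * c * q powi (- int N) / a,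
      c * d * q powi (1 + int N) / a] q k \<noteq> 0"
    and inf_defined: "qpochs_inf
          [c * q, q / c, d * q, q / d, c * q / a, a * q / c, d * q / a, a * q / d] q \<noteq> 0"
  shows "((\<lambda>i. product_side (a' i) (b' i) (c' i) (d' i) k N) \<longlongrightarrow> product_side a b c d k N) F"
proof (cases "k \<ge> 0")
  case True
  note unf = product_side_def qpochs_def qpochs_inf_def list.map prod_list.Cons prod_list.Nil mult_1_right
  show ?thesis
    unfolding unf
    by (intro tendsto_mult tendsto_divide tendsto_qpoch tendsto_qpoch_inf lim tendsto_const True
          N_defined[unfolded unf] k_defined[OF True, unfolded unf] inf_defined[unfolded unf] nz
          no_zero_divisors of_nat_0_le_iff)
qed (simp add: product_side_outside_0)

lemma scaling_tendsto:
  fixes s :: "nat \<Rightarrow> real"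
  assumes "s \<longlonglongrightarrow> 1"
  shows "(\<lambda>i. w * of_real (s i) ^ p :: complex) \<longlonglongrightarrow> w"
  using tendsto_mult[OF tendsto_const[of w] tendsto_power[OF tendsto_of_real[OF assms], of p]] by simp

text \<open>
  The parameters \<open>sa\<close>, \<open>a\<close>, \<open>b\<close>, \<open>c\<close>, \<open>d\<close> are multiplied by the powers \<open>5\<close>, \<open>10\<close>, \<open>20\<close>, \<open>1\<close>, \<open>3\<close> of
  \<open>s\<close>.  The exponents are chosen such that \<open>sa\<^sup>2 = a\<close> is preserved and that every monomial required
  to be off the lattice in \<open>psi_generic\<close> is multiplied by a nonzero power of \<open>s\<close>.
\<close>

theorem psi_eq_product_side:
  fixes N :: nat
  assumes sa: "sa ^ 2 = a" and nz: "a \<noteq> 0" "b \<noteq> 0" "c \<noteq> 0" "d \<noteq> 0"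
    and defined: "psi_defined (upper_params sa a b c d k N) (lower_params sa a b c d k N) q"
    and N_defined: "qpochs [c * d * q / a, d * q / c, q / b, a * q / b] q (int N) \<noteq> 0"
    and k_defined: "k \<ge> 0 \<Longrightarrow> qpochs [q, c * q / b, d / a, d, b * c * q powi (- int N) / a,
      c * d * q powi (1 + int N) / a] q k \<noteq> 0"
    and inf_defined: "qpochs_inf
          [c * q, q / c, d * q, q / d, c * q / a, a * q / c, d * q / a, a * q / d] q \<noteq> 0"
  shows "psi_term (upper_params sa a b c d k N) (lower_params sa a b c d k N) q q summable_on UNIV"
    and "psi (upper_params sa a b c d k N) (lower_params sa a b c d k N) q q = product_side a b c d k N"
proof -
  \<comment> \<open>The monomials of \<open>psi_generic\<close> with the power of \<open>s\<close> that each acquires.\<close>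
  define I :: "(complex \<times> int) set" where "I = {(a, 10), (b, 20), (a / b, -10), (c, 1), (a / c, 9), (d, 3), (a / d, 7),
    (c * c / a, -8), (d * d / a, -4), (c / d, -2), (c * d / a, -6), (c / b, -19), (b * c / a, 11)}"
  have I: "countable I" "\<And>w p. (w, p) \<in> I \<Longrightarrow> w \<noteq> 0 \<and> p \<noteq> 0"
    unfolding I_def using nz by auto
  obtain s :: "nat \<Rightarrow> real" where s: "s \<longlonglongrightarrow> 1" "\<And>i. s i > 0"
    and off: "\<And>i w p. (w, p) \<in> I \<Longrightarrow> off_lattice (w * of_real (s i) powi p)"
    by (rule generic_scaling_sequence[OF I]) auto
  define sa' a' b' c' d' where "sa' i = sa * of_real (s i) ^ 5" and "a' i = a * of_real (s i) ^ 10"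
    and "b' i = b * of_real (s i) ^ 20" and "c' i = c * of_real (s i) ^ 1" and "d' i = d * of_real (s i) ^ 3"
    for i
  have lim: "sa' \<longlonglongrightarrow> sa" "a' \<longlonglongrightarrow> a" "b' \<longlonglongrightarrow> b" "c' \<longlonglongrightarrow> c" "d' \<longlonglongrightarrow> d"
    unfolding sa'_def[abs_def] a'_def[abs_def] b'_def[abs_def] c'_def[abs_def] d'_def[abs_def]
    by (rule scaling_tendsto[OF s(1)])+
  have generic: "psi (upper_params (sa' i) (a' i) (b' i) (c' i) (d' i) k N) (lower_params (sa' i) (a' i) (b' i) (c' i) (d' i) k N) q q =
     product_side (a' i) (b' i) (c' i) (d' i) k N" for i
  proof -
    define t :: complex where "t = of_real (s i)"
    have t: "t \<noteq> 0"
      using s(2)[of i] by (simp add: t_def)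
    have quot: "x * t ^ m / (y * t ^ n) = x / y * t powi (int m - int n)" for x y m n
      using t by (simp add: power_int_diff)
    have prod: "x * t ^ m * (y * t ^ n) = x * y * t ^ (m + n)" for x y m n
      by (simp add: power_add)
    have pw: "x * t ^ m = x * t powi int m" for x m
      by simp
    have off': "off_lattice (w * t powi p)" if "(w, p) \<in> I" for w p
      using off[OF that] by (simp add: t_def)
    show ?thesis
    proof (rule psi_generic)
      show "sa' i ^ 2 = a' i"
        by (simp add: sa'_def a'_def power_mult_distrib sa flip: power_mult)
      show "a' i \<noteq> 0" "b' i \<noteq> 0" "c' i \<noteq> 0" "d' i \<noteq> 0"
        using nz t by (simp_all add: a'_def b'_def c'_def d'_def t_def)
    qed (unfold a'_def b'_def c'_def d'_def t_def[symmetric] prod quot, (unfold pw)?, (rule off', simp add: I_def)+)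
  qed
  let ?fs = "[\<lambda>i. q * sa' i, \<lambda>i. - q * sa' i, b', c', \<lambda>i. d' i * q powi k, \<lambda>i. a' i * q powi (-k) / c' i,
     \<lambda>i. a' i * q powi (1 + int N) / b' i, \<lambda>i. a' i * q powi (- int N) / d' i]"
  let ?gs = "[sa', \<lambda>i. - sa' i, \<lambda>i. a' i * q / b' i, \<lambda>i. a' i * q / c' i, \<lambda>i. a' i * q powi (1 - k) / d' i,
     \<lambda>i. c' i * q powi (1 + k), \<lambda>i. b' i * q powi (- int N), \<lambda>i. d' i * q powi (1 + int N)]"
  have fs: "list_all2 (\<lambda>f x. f \<longlonglongrightarrow> x) ?fs (upper_params sa a b c d k N)"
    and gs: "list_all2 (\<lambda>f x. f \<longlonglongrightarrow> x) ?gs (lower_params sa a b c d k N)"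
    unfolding upper_params_def lower_params_def
    by (intro list.rel_intros tendsto_mult tendsto_divide tendsto_minus tendsto_const lim nz)+
  have sa0: "sa \<noteq> 0"
    using sa nz by auto
  have nz_lists: "0 \<notin> set (upper_params sa a b c d k N)" "0 \<notin> set (lower_params sa a b c d k N)"
    "length (upper_params sa a b c d k N) = length (lower_params sa a b c d k N)"
    using nz sa0 by (auto simp: upper_params_def lower_params_def)
  have "prod_list (lower_params sa a b c d k N) / prod_list (upper_params sa a b c d k N) / q = q"
  proof -
    have e: "q powi (1 + int N) = q * q ^ N" "q powi (- int N) = 1 / q ^ N" "q powi (1 - k) = q / q powi k"
      "q powi (1 + k) = q * q powi k" "q powi (- k) = 1 / q powi k"
      by (simp_all add: power_int_add power_int_diff power_int_minus_divide)
    show ?thesis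
      unfolding upper_params_def lower_params_def e using nz sa0 by (simp add: divide_simps)
  qed
  then have conv: "norm (prod_list (lower_params sa a b c d k N) / prod_list (upper_params sa a b c d k N) / q) < 1"
    using q_less_1 by simp
  note limit = psi_tendsto[OF fs gs sequentially_bot defined nz_lists q_less_1 conv]
  show "psi_term (upper_params sa a b c d k N) (lower_params sa a b c d k N) q q summable_on UNIV"
    by (rule limit(1))
  have "(\<lambda>i. product_side (a' i) (b' i) (c' i) (d' i) k N) \<longlonglongrightarrow> psi (upper_params sa a b c d k N) (lower_params sa a b c d k N) q q"
    using limit(2) generic by (simp add: upper_params_def lower_params_def)
  moreover have "(\<lambda>i. product_side (a' i) (b' i) (c' i) (d' i) k N) \<longlonglongrightarrow> product_side a b c d k N"
    by (intro product_side_tendsto lim nz N_defined k_defined inf_defined)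
  ultimately show "psi (upper_params sa a b c d k N) (lower_params sa a b c d k N) q q = product_side a b c d k N"
    by (rule LIMSEQ_unique)
qed

end

theorem theorem4p1:
  fixes q a b c d sa :: complex and k :: int and N :: nat and xs ys :: "complex list"
  assumes q: "0 < norm q" "norm q < 1"
    and nonzero: "a \<noteq> 0" "b \<noteq> 0" "c \<noteq> 0" "d \<noteq> 0"
    and sa: "sa ^ 2 = a"
    and xs: "xs = [q * sa, - q * sa, b, c, d * q powi k, a * q powi (-k) / c,
                   a * q powi (1 + int N) / b, a * q powi (- int N) / d]"
    and ys: "ys = [sa, - sa, a * q / b, a * q / c, a * q powi (1 - k) / d, c * q powi (1 + k),
                   b * q powi (- int N), d * q powi (1 + int N)]"
    and series_defined: "psi_defined xs ys q"
    and N_quotient_defined: "qpochs_quotient_defined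
          [a * q / (b * c), c * q / b, d * q, d * q / a]
          [c * d * q / a, d * q / c, q / b, a * q / b] q (int N)"
    and k_quotient_defined: "qpochs_quotient_defined
          [c * d / a, b * d / a, c * q, c * q / a, d * q powi (1 + int N) / b, q powi (- int N)]
          [q, c * q / b, d / a, d, b * c * q powi (- int N) / a, c * d * q powi (1 + int N) / a] q k"
    and inf_quotient_defined: "qpochs_inf
          [c * q, q / c, d * q, q / d, c * q / a, a * q / c, d * q / a, a * q / d] q \<noteq> 0"
  shows "psi_term xs ys q q summable_on UNIV \<and>
    psi xs ys q q =
      qpochs [a * q / (b * c), c * q / b, d * q, d * q / a] q (int N) /
      qpochs [c * d * q / a, d * q / c, q / b, a * q / b] q (int N) *
      (qpochs [c * d / a, b * d / a, c * q, c * q / a, d * q powi (1 + int N) / b,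
               q powi (- int N)] q k /
       qpochs [q, c * q / b, d / a, d, b * c * q powi (- int N) / a,
               c * d * q powi (1 + int N) / a] q k) *
      (qpochs_inf [q, q, a * q, q / a, c * d * q / a, a * q / (c * d), c * q / d, d * q / c] q /
       qpochs_inf [c * q, q / c, d * q, q / d, c * q / a, a * q / c, d * q / a, a * q / d] q)"
proof -
  interpret nome q
    by unfold_locales (rule q)+
  have lists: "xs = upper_params sa a b c d k N" "ys = lower_params sa a b c d k N"
    unfolding xs ys upper_params_def lower_params_def by (rule refl)+
  note N_def' = qpochs_nonzero_of_defined[OF N_quotient_defined of_nat_0_le_iff]
  note k_def' = qpochs_nonzero_of_defined[OF k_quotient_defined]
  show ?thesis
    using psi_eq_product_side[OF sa nonzero series_defined[unfolded lists] N_def' k_def' inf_quotient_defined]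
    unfolding lists product_side_def by blast
qed

end
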